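(* Let $(X,(\mathcal U',\mathcal K'),(\mathcal U'',\mathcal K''),\mathcal K'_+\subset\mathcal K',\mathcal K''_-\subset\mathcal K'')$ be a data set for a Lifting Problem, let $U_0=\begin{bmatrix}A_0&B_0\\ C_0&0\end{bmatrix}:\mathcal H_0\oplus\widetilde\Delta_*\to\mathcal H_0\oplus\widetilde\Delta$ be the universal unitary colligation constructed from these data, and let $S_0^\pm,S_1^+,S_2^+,S^+$ be the associated augmented input-output maps. Let $\mathcal G'\subset\mathcal K'_+$ and $\mathcal G''\subset\mathcal K''_-$ be subspaces which are $*$-cyclic for $\mathcal U'$ and $\mathcal U''$ respectively. Let $i_{\mathcal G'}:\mathcal G'\to\mathcal H_0$ be the inclusion of $\mathcal G'$ in $\mathcal K'_+$ followed by the inclusion of $\mathcal K'_+$ in $\mathcal H_0$, let $i_{\mathcal G''}:\mathcal G''\to\mathcal H_0$ be the inclusion of $\mathcal G''$ in $\mathcal K''_-$ followed by the inclusion of $\mathcal K''_-$ in $\mathcal H_0$, and let $\mathcal I_{\mathcal G''}^*$ be the coordinatewise application of $i_{\mathcal G''}^*$ to $\mathcal H_0$-valued sequences. Then an $\mathcal L(\mathcal G',\mathcal G'')$-valued bilateral sequence $w=\{w(n)\}_{n\in\mathbb Z}$ is the symbol $w=w_Y$ (with respect to $\mathcal G'$ and $\mathcal G''$) of a contractive intertwining lift $Y$ of $X$ if and only if there exists a unitary colligation $U_1=\begin{bmatrix}A_1&B_1\\ C_1&D_1\end{bmatrix}:\mathcal H_1\oplus\widetilde\Delta\to\mathcal H_1\oplus\widetilde\Delta_*$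 ($\mathcal H_1$ a Hilbert space), with input-output map $\Omega^+$, so that $w$, written as an infinite column vector (first block: indices $n\in\mathbb Z_-$; second block: indices $n\in\mathbb Z_+$), has the form $$w=\begin{bmatrix}\mathcal I_{\mathcal G''}^*S_0^-i_{\mathcal G'}\\[2pt] \mathcal I_{\mathcal G''}^*\left[S_0^++S_2^+(I-\Omega^+S^+)^{-1}\Omega^+S_1^+\right]i_{\mathcal G'}\end{bmatrix}.$$
   Context: Notation: $\mathbb Z_+=\{0,1,\dots\}$, $\mathbb Z_-=\{-1,-2,\dots\}$; $\ell_{\mathcal G}(\cdot)$ is the space of all $\mathcal G$-valued sequences on the indicated index set. A subspace is $*$-cyclic for a unitary operator if the smallest reducing subspace containing it is the whole space. Lifting Problem data: $\mathcal U',\mathcal U''$ are unitary operators on Hilbert spaces $\mathcal K',\mathcal K''$; $\mathcal K'_+\subset\mathcal K'$, $\mathcal K''_-\subset\mathcal K''$ are subspaces, $*$-cyclic for $\mathcal U'$, $\mathcal U''$ respectively, with $\mathcal U'\mathcal K'_+\subset\mathcal K'_+$ and $\mathcal U''^*\mathcal K''_-\subset\mathcal K''_-$; $X:\mathcal K'_+\to\mathcal K''_-$ is a contraction with $X\mathcal U'|_{\mathcal K'_+}=P_{\mathcal K''_-}\mathcal U''X$. A contractive intertwining lift of $X$ is an operator $Y:\mathcal K'\to\mathcal K''$ with $\|Y\|\le1$, $Y\mathcal U'=\mathcal U''Y$ and $P_{\mathcal K''_-}Y|_{\mathcal K'_+}=X$. The symbol of $Y$ with respect to $\mathcal G',\mathcal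 G''$ is $w_Y(n)=i^*_{\mathcal G''\to\mathcal K''}\,\mathcal U''^{*n}\,Y\,i_{\mathcal G'\to\mathcal K'}$, $n\in\mathbb Z$, where $i_{\mathcal G'\to\mathcal K'},i_{\mathcal G''\to\mathcal K''}$ are inclusions. Universal unitary colligation: $\mathcal H_0$ is the Hilbert space completion of the space of pairs $\begin{bmatrix}k''_-\\ k'_+\end{bmatrix}$, $k''_-\in\mathcal K''_-$, $k'_+\in\mathcal K'_+$, in the inner product $$\left\langle\begin{bmatrix}k''_-\\ k'_+\end{bmatrix},\begin{bmatrix}\ell''_-\\ \ell'_+\end{bmatrix}\right\rangle_{\mathcal H_0}=\left\langle\begin{bmatrix}I&X\\ X^*&I\end{bmatrix}\begin{bmatrix}k''_-\\ k'_+\end{bmatrix},\begin{bmatrix}\ell''_-\\ \ell'_+\end{bmatrix}\right\rangle_{\mathcal K''_-\oplus\mathcal K'_+}$$ (vectors of zero norm identified with $0$); $\mathcal K''_-$ and $\mathcal K'_+$ embed isometrically in $\mathcal H_0$ by $k''_-\mapsto\begin{bmatrix}k''_-\\ 0\end{bmatrix}$, $k'_+\mapsto\begin{bmatrix}0\\ k'_+\end{bmatrix}$. Put $\mathcal D=\operatorname{clos}\begin{bmatrix}\mathcal K''_-\\ \mathcal U'\mathcal K'_+\end{bmatrix}$, $\mathcal D_*=\operatorname{clos}\begin{bmatrix}\mathcal U''^*\mathcal K''_-\\ \mathcal K'_+\end{bmatrix}$ in $\mathcal H_0$, and let $V:\mathcal D\to\mathcal D_*$ be the unitary map determined by $\begin{bmatrix}k''_-\\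 \mathcal U'k'_+\end{bmatrix}\mapsto\begin{bmatrix}\mathcal U''^*k''_-\\ k'_+\end{bmatrix}$. Let $\Delta=\mathcal H_0\ominus\mathcal D$, $\Delta_*=\mathcal H_0\ominus\mathcal D_*$, and let $\widetilde\Delta,\widetilde\Delta_*$ be copies of $\Delta,\Delta_*$ with unitary identification maps $i_{\widetilde\Delta}:\widetilde\Delta\to\Delta\subset\mathcal H_0$, $i_{\widetilde\Delta_*}:\widetilde\Delta_*\to\Delta_*\subset\mathcal H_0$. Then $A_0|_{\mathcal D}=V$, $A_0|_\Delta=0$, $B_0=i_{\widetilde\Delta_*}$, $C_0|_{\mathcal D}=0$, $C_0|_\Delta=i_{\widetilde\Delta}^*$. Augmented input-output maps: for $h\in\mathcal H_0$, $\vec d\in\ell_{\widetilde\Delta_*}(\mathbb Z_+)$ and $n\ge0$: $(S_0^+h)(n)=A_0^nh$, $(S_2^+\vec d)(n)=\sum_{k=0}^{n-1}A_0^{n-1-k}B_0d(k)$, $(S_1^+h)(n)=C_0A_0^nh$, $(S^+\vec d)(n)=\sum_{k=0}^{n-1}C_0A_0^{n-1-k}B_0d(k)$; for $n\le-1$, $(S_0^-h)(n)=A_0^{*|n|}h$. A unitary colligation is a colligation whose block operator is unitary; its input-output map is $\Omega^+:\ell_{\widetilde\Delta}(\mathbb Z_+)\to\ell_{\widetilde\Delta_*}(\mathbb Z_+)$, $(\Omega^+\vec e)(n)=D_1e(n)+\sum_{k=0}^{n-1}C_1A_1^{n-1-k}B_1e(k)$. (The operator $I-\Omega^+S^+$ is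 always invertible on $\ell_{\widetilde\Delta_*}(\mathbb Z_+)$.) *)

theory Defs
  imports "HOL-Analysis.Analysis"
begin

section \<open>Complex Hilbert spaces\<close>

text \<open>
  A complex inner product space is a real one (supplying norm and topology) together with a
  complex scalar multiplication and a sesquilinear form, linear in the \<^emph>\<open>first\<close> argument,
  whose real part is the real inner product.
\<close>

class complex_inner = real_inner +
  fixes scaleC :: "complex \<Rightarrow> 'a \<Rightarrow> 'a"  (infixr \<open>*\<^sub>C\<close> 75)
    and cinner :: "'a \<Rightarrow> 'a \<Rightarrow> complex"
  assumes scaleC_add_right: "c *\<^sub>C (x + y) = c *\<^sub>C x + c *\<^sub>C y"
    and scaleC_add_left: "(b + c) *\<^sub>C x = b *\<^sub>C x + c *\<^sub>C x"
    and scaleC_scaleC: "b *\<^sub>C (c *\<^sub>C x) = (b * c) *\<^sub>C x"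
    and scaleC_of_real: "complex_of_real r *\<^sub>C x = r *\<^sub>R x"
    and cinner_commute: "cinner x y = cnj (cinner y x)"
    and cinner_add_left: "cinner (x + y) z = cinner x z + cinner y z"
    and cinner_scaleC_left: "cinner (c *\<^sub>C x) y = c * cinner x y"
    and inner_eq_Re_cinner: "x \<bullet> y = Re (cinner x y)"

class chilbert_space = complex_inner + banach

instantiation complex :: chilbert_space
begin
definition "c *\<^sub>C (x::complex) = c * x"
definition "cinner x y = x * cnj (y::complex)"
instance
  by standard (simp_all add: scaleC_complex_def cinner_complex_def inner_complex_def
      algebra_simps scaleR_conv_of_real)
end

instantiation prod :: (complex_inner, complex_inner) complex_inner
begin
definition "c *\<^sub>C p = (c *\<^sub>C fst p, c *\<^sub>C snd p)"
definition "cinner p q = cinner (fst p) (fst q) + cinner (snd p) (snd q)"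
instance
proof
  fix x y :: "'a \<times> 'b"
  show "cinner x y = cnj (cinner y x)"
    using cinner_commute[of "fst x" "fst y"] cinner_commute[of "snd x" "snd y"]
    by (simp add: cinner_prod_def)
qed (simp_all add: scaleC_prod_def cinner_prod_def scaleC_add_right scaleC_add_left
    scaleC_scaleC scaleC_of_real cinner_add_left cinner_scaleC_left inner_prod_def
    inner_eq_Re_cinner algebra_simps scaleR_prod_def)
end

instance prod :: (chilbert_space, chilbert_space) chilbert_space ..


section \<open>Subspaces and operators between subspaces\<close>

text \<open>
  Hilbert spaces that are not whole types are closed subspaces of a type of class
  \<^class>\<open>chilbert_space\<close>. An operator from \<open>S\<close> to \<open>T\<close> is a function on the ambient types;
  only its values on \<open>S\<close> matter.
\<close>

definition closed_csubspace :: "'a::complex_inner set \<Rightarrow> bool" where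
  "closed_csubspace S \<longleftrightarrow>
     0 \<in> S \<and> (\<forall>x\<in>S. \<forall>y\<in>S. x + y \<in> S) \<and> (\<forall>c. \<forall>x\<in>S. c *\<^sub>C x \<in> S) \<and> closed S"

definition clinear_on :: "'a::complex_inner set \<Rightarrow> ('a \<Rightarrow> 'b::complex_inner) \<Rightarrow> bool" where
  "clinear_on S f \<longleftrightarrow>
     (\<forall>x\<in>S. \<forall>y\<in>S. f (x + y) = f x + f y) \<and> (\<forall>c. \<forall>x\<in>S. f (c *\<^sub>C x) = c *\<^sub>C f x)"

definition bounded_op ::
  "'a::complex_inner set \<Rightarrow> 'b::complex_inner set \<Rightarrow> ('a \<Rightarrow> 'b) \<Rightarrow> bool" where
  "bounded_op S T f \<longleftrightarrow>
     clinear_on S f \<and> f ` S \<subseteq> T \<and> (\<exists>M. \<forall>x\<in>S. norm (f x) \<le> M * norm x)"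

definition contraction_op ::
  "'a::complex_inner set \<Rightarrow> 'b::complex_inner set \<Rightarrow> ('a \<Rightarrow> 'b) \<Rightarrow> bool" where
  "contraction_op S T f \<longleftrightarrow>
     clinear_on S f \<and> f ` S \<subseteq> T \<and> (\<forall>x\<in>S. norm (f x) \<le> norm x)"

definition unitary_op ::
  "'a::complex_inner set \<Rightarrow> 'b::complex_inner set \<Rightarrow> ('a \<Rightarrow> 'b) \<Rightarrow> bool" where
  "unitary_op S T f \<longleftrightarrow>
     clinear_on S f \<and> f ` S = T \<and> (\<forall>x\<in>S. \<forall>y\<in>S. cinner (f x) (f y) = cinner x y)"

definition proj :: "'a::complex_inner set \<Rightarrow> 'a \<Rightarrow> 'a" where
  "proj S x = (THE p. p \<in> S \<and> (\<forall>s\<in>S. cinner (x - p) s = 0))"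

text \<open>\<open>hadjoint S f\<close> is the Hilbert space adjoint, with values in \<open>S\<close>, of \<open>f\<close> regarded as an
  operator with domain \<open>S\<close>.\<close>

definition hadjoint :: "'a::complex_inner set \<Rightarrow> ('a \<Rightarrow> 'b::complex_inner) \<Rightarrow> 'b \<Rightarrow> 'a" where
  "hadjoint S f y = (THE x. x \<in> S \<and> (\<forall>z\<in>S. cinner (f z) y = cinner z x))"

definition ominus :: "'a::complex_inner set \<Rightarrow> 'a set \<Rightarrow> 'a set" where
  "ominus S T = {x \<in> S. \<forall>t\<in>T. cinner x t = 0}"

definition reducing :: "('a::complex_inner \<Rightarrow> 'a) \<Rightarrow> 'a set \<Rightarrow> bool" where
  "reducing U M \<longleftrightarrow> closed_csubspace M \<and> U ` M \<subseteq> M \<and> hadjoint UNIV U ` M \<subseteq> M"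

definition star_cyclic :: "('a::complex_inner \<Rightarrow> 'a) \<Rightarrow> 'a set \<Rightarrow> bool" where
  "star_cyclic U S \<longleftrightarrow> \<Inter>{M. reducing U M \<and> S \<subseteq> M} = UNIV"


section \<open>The Lifting Problem\<close>

definition lifting_data ::
  "('a::chilbert_space \<Rightarrow> 'b::chilbert_space) \<Rightarrow> ('a \<Rightarrow> 'a) \<Rightarrow> ('b \<Rightarrow> 'b) \<Rightarrow> 'a set \<Rightarrow> 'b set \<Rightarrow> bool"
  where
  "lifting_data X U' U'' Kp Km \<longleftrightarrow>
     unitary_op UNIV UNIV U' \<and> unitary_op UNIV UNIV U'' \<and>
     closed_csubspace Kp \<and> closed_csubspace Km \<and>
     star_cyclic U' Kp \<and> star_cyclic U'' Km \<and>
     U' ` Kp \<subseteq> Kp \<and> hadjoint UNIV U'' ` Km \<subseteq> Km \<and>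
     contraction_op Kp Km X \<and>
     (\<forall>k\<in>Kp. X (U' k) = proj Km (U'' (X k)))"

definition contractive_intertwining_lift ::
  "('a::chilbert_space \<Rightarrow> 'b::chilbert_space) \<Rightarrow> ('a \<Rightarrow> 'a) \<Rightarrow> ('b \<Rightarrow> 'b) \<Rightarrow> 'a set \<Rightarrow> 'b set
    \<Rightarrow> ('a \<Rightarrow> 'b) \<Rightarrow> bool" where
  "contractive_intertwining_lift X U' U'' Kp Km Y \<longleftrightarrow>
     contraction_op UNIV UNIV Y \<and> (\<forall>k. Y (U' k) = U'' (Y k)) \<and>
     (\<forall>k\<in>Kp. proj Km (Y k) = X k)"

definition adj_power :: "('b::complex_inner \<Rightarrow> 'b) \<Rightarrow> int \<Rightarrow> 'b \<Rightarrow> 'b" where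
  "adj_power U n = (if 0 \<le> n then hadjoint UNIV U ^^ nat n else U ^^ nat (- n))"

text \<open>The inclusion of \<open>G'\<close> is invisible here: \<open>symbol U'' G'' Y n\<close> is only meaningful on \<open>G'\<close>.\<close>

definition symbol ::
  "('b::chilbert_space \<Rightarrow> 'b) \<Rightarrow> 'b set \<Rightarrow> ('a::chilbert_space \<Rightarrow> 'b) \<Rightarrow> int \<Rightarrow> 'a \<Rightarrow> 'b" where
  "symbol U'' G'' Y n g = hadjoint G'' (\<lambda>x. x) (adj_power U'' n (Y g))"


section \<open>The universal unitary colligation\<close>

text \<open>
  \<open>H0\<close> with the map \<open>J\<close> is a Hilbert space completion of the space of pairs \<open>(k'', k')\<close>: \<open>J\<close> has
  dense range and transports the inner product induced by the Gram matrix \<open>[I, X; X\<^sup>*, I]\<close>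
  (so the vectors of zero norm are exactly those sent to 0). Completions are unique
  up to a unitary map compatible with \<open>J\<close>.
  The embeddings of \<open>Km\<close> and \<open>Kp\<close> are \<open>\<lambda>k. J (k, 0)\<close> and \<open>\<lambda>k. J (0, k)\<close>.
\<close>

definition gram_completion ::
  "('a::chilbert_space \<Rightarrow> 'b::chilbert_space) \<Rightarrow> 'a set \<Rightarrow> 'b set
    \<Rightarrow> 'h::chilbert_space set \<Rightarrow> ('b \<times> 'a \<Rightarrow> 'h) \<Rightarrow> bool" where
  "gram_completion X Kp Km H0 J \<longleftrightarrow>
     closed_csubspace H0 \<and> clinear_on (Km \<times> Kp) J \<and>
     (\<forall>k''\<in>Km. \<forall>k'\<in>Kp. \<forall>l''\<in>Km. \<forall>l'\<in>Kp.
        cinner (J (k'', k')) (J (l'', l')) =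
        cinner (k'' + X k', hadjoint Kp X k'' + k') (l'', l')) \<and>
     closure (J ` (Km \<times> Kp)) = H0"

definition univ_dom ::
  "('a::chilbert_space \<Rightarrow> 'a) \<Rightarrow> 'a set \<Rightarrow> 'b::chilbert_space set
    \<Rightarrow> ('b \<times> 'a \<Rightarrow> 'h::chilbert_space) \<Rightarrow> 'h set" where
  "univ_dom U' Kp Km J = closure (J ` (Km \<times> U' ` Kp))"

definition univ_ran ::
  "('b::chilbert_space \<Rightarrow> 'b) \<Rightarrow> 'a::chilbert_space set \<Rightarrow> 'b set
    \<Rightarrow> ('b \<times> 'a \<Rightarrow> 'h::chilbert_space) \<Rightarrow> 'h set" where
  "univ_ran U'' Kp Km J = closure (J ` (hadjoint UNIV U'' ` Km \<times> Kp))"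

text \<open>The choice is determined on \<open>univ_dom U' Kp Km J\<close> (prescribed on a dense subspace and
  isometric), and its values elsewhere are never used.\<close>

definition univ_V ::
  "('a::chilbert_space \<Rightarrow> 'a) \<Rightarrow> ('b::chilbert_space \<Rightarrow> 'b) \<Rightarrow> 'a set \<Rightarrow> 'b set
    \<Rightarrow> ('b \<times> 'a \<Rightarrow> 'h::chilbert_space) \<Rightarrow> 'h \<Rightarrow> 'h" where
  "univ_V U' U'' Kp Km J =
     (SOME V. unitary_op (univ_dom U' Kp Km J) (univ_ran U'' Kp Km J) V \<and>
        (\<forall>k''\<in>Km. \<forall>k'\<in>Kp. V (J (k'', U' k')) = J (hadjoint UNIV U'' k'', k')))"

definition univ_A ::
  "('a::chilbert_space \<Rightarrow> 'a) \<Rightarrow> ('b::chilbert_space \<Rightarrow> 'b) \<Rightarrow> 'a set \<Rightarrow> 'b set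
    \<Rightarrow> ('b \<times> 'a \<Rightarrow> 'h::chilbert_space) \<Rightarrow> 'h \<Rightarrow> 'h" where
  "univ_A U' U'' Kp Km J h = univ_V U' U'' Kp Km J (proj (univ_dom U' Kp Km J) h)"

text \<open>\<open>iDt\<close> is the identification map of a copy \<open>Dt\<close> of the defect space \<open>Dl\<close> with \<open>Dl\<close>.\<close>

definition univ_C ::
  "'h::chilbert_space set \<Rightarrow> 'd::chilbert_space set \<Rightarrow> ('d \<Rightarrow> 'h) \<Rightarrow> 'h \<Rightarrow> 'd" where
  "univ_C Dl Dt iDt h = hadjoint Dt iDt (proj Dl h)"

text \<open>Augmented input-output maps\<close>

definition S0_plus :: "('h \<Rightarrow> 'h) \<Rightarrow> 'h \<Rightarrow> nat \<Rightarrow> 'h" where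
  "S0_plus A0 h n = (A0 ^^ n) h"

definition S2_plus ::
  "('h::chilbert_space \<Rightarrow> 'h) \<Rightarrow> ('s \<Rightarrow> 'h) \<Rightarrow> (nat \<Rightarrow> 's) \<Rightarrow> nat \<Rightarrow> 'h" where
  "S2_plus A0 B0 d n = (\<Sum>k<n. (A0 ^^ (n - 1 - k)) (B0 (d k)))"

definition S1_plus :: "('h \<Rightarrow> 'h) \<Rightarrow> ('h \<Rightarrow> 'd) \<Rightarrow> 'h \<Rightarrow> nat \<Rightarrow> 'd" where
  "S1_plus A0 C0 h n = C0 ((A0 ^^ n) h)"

definition S_plus ::
  "('h \<Rightarrow> 'h) \<Rightarrow> ('s \<Rightarrow> 'h) \<Rightarrow> ('h \<Rightarrow> 'd::chilbert_space) \<Rightarrow> (nat \<Rightarrow> 's) \<Rightarrow> nat \<Rightarrow> 'd" where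
  "S_plus A0 B0 C0 d n = (\<Sum>k<n. C0 ((A0 ^^ (n - 1 - k)) (B0 (d k))))"

text \<open>The index \<open>n\<close> of \<open>S0_minus\<close> ranges over the negative integers.\<close>

definition S0_minus :: "'h::chilbert_space set \<Rightarrow> ('h \<Rightarrow> 'h) \<Rightarrow> 'h \<Rightarrow> int \<Rightarrow> 'h" where
  "S0_minus H0 A0 h n = (hadjoint H0 A0 ^^ nat \<bar>n\<bar>) h"


section \<open>Unitary colligations and the parametrization formula\<close>

definition unitary_colligation ::
  "'h::chilbert_space set \<Rightarrow> 'd::chilbert_space set \<Rightarrow> 's::chilbert_space set
    \<Rightarrow> ('h \<Rightarrow> 'h) \<Rightarrow> ('d \<Rightarrow> 'h) \<Rightarrow> ('h \<Rightarrow> 's) \<Rightarrow> ('d \<Rightarrow> 's) \<Rightarrow> bool" where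
  "unitary_colligation H E F A B C D \<longleftrightarrow>
     closed_csubspace H \<and>
     bounded_op H H A \<and> bounded_op E H B \<and> bounded_op H F C \<and> bounded_op E F D \<and>
     unitary_op (H \<times> E) (H \<times> F) (\<lambda>(h, e). (A h + B e, C h + D e))"

definition io_map ::
  "('h \<Rightarrow> 'h) \<Rightarrow> ('d \<Rightarrow> 'h) \<Rightarrow> ('h \<Rightarrow> 's::chilbert_space) \<Rightarrow> ('d \<Rightarrow> 's)
    \<Rightarrow> (nat \<Rightarrow> 'd) \<Rightarrow> nat \<Rightarrow> 's" where
  "io_map A B C D e n = D (e n) + (\<Sum>k<n. C ((A ^^ (n - 1 - k)) (B (e k))))"

text \<open>\<open>feedback_inv F T\<close> is the inverse of \<open>I - T\<close> on the space of all \<open>F\<close>-valued sequences.\<close>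

definition feedback_inv ::
  "'s::chilbert_space set \<Rightarrow> ((nat \<Rightarrow> 's) \<Rightarrow> nat \<Rightarrow> 's) \<Rightarrow> (nat \<Rightarrow> 's) \<Rightarrow> nat \<Rightarrow> 's" where
  "feedback_inv F T = inv_into {d. \<forall>n. d n \<in> F} (\<lambda>d n. d n - T d n)"

text \<open>The two block rows of the bilateral column are the two branches of the conditional.\<close>

definition symbol_column ::
  "'b::chilbert_space set \<Rightarrow> ('b \<times> 'a::chilbert_space \<Rightarrow> 'h::chilbert_space) \<Rightarrow> 'h set
    \<Rightarrow> 's::chilbert_space set \<Rightarrow> ('h \<Rightarrow> 'h) \<Rightarrow> ('s \<Rightarrow> 'h) \<Rightarrow> ('h \<Rightarrow> 'd::chilbert_space)
    \<Rightarrow> ((nat \<Rightarrow> 'd) \<Rightarrow> nat \<Rightarrow> 's) \<Rightarrow> int \<Rightarrow> 'a \<Rightarrow> 'b" where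
  "symbol_column G'' J H0 F A0 B0 C0 \<Omega> n g =
     hadjoint G'' (\<lambda>x. J (x, 0))
       (if n < 0 then S0_minus H0 A0 (J (0, g)) n
        else S0_plus A0 (J (0, g)) (nat n) +
          S2_plus A0 B0
            (feedback_inv F (\<lambda>d. \<Omega> (S_plus A0 B0 C0 d)) (\<Omega> (S1_plus A0 C0 (J (0, g)))))
            (nat n))"

text \<open>
  HOL cannot quantify existentially over types, so ``there is a Hilbert space \<open>H\<^sub>1\<close>'' needs an
  ambient type. In the theorem, \<open>H\<^sub>1\<close> is produced inside the product of the two given
  Hilbert spaces, while in the converse direction it may lie in an arbitrary
  type of class \<^class>\<open>chilbert_space\<close>; the two together give the equivalence for \<open>H\<^sub>1\<close> of any size.
\<close>

definition colligation_symbol ::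
  "'h1::chilbert_space itself \<Rightarrow> 'a::chilbert_space set \<Rightarrow> 'b::chilbert_space set
    \<Rightarrow> ('b \<times> 'a \<Rightarrow> 'h::chilbert_space) \<Rightarrow> 'h set
    \<Rightarrow> 'd::chilbert_space set \<Rightarrow> 's::chilbert_space set
    \<Rightarrow> ('h \<Rightarrow> 'h) \<Rightarrow> ('s \<Rightarrow> 'h) \<Rightarrow> ('h \<Rightarrow> 'd) \<Rightarrow> (int \<Rightarrow> 'a \<Rightarrow> 'b) \<Rightarrow> bool" where
  "colligation_symbol (_ :: 'h1 itself) G' G'' J H0 E F A0 B0 C0 w \<longleftrightarrow>
     (\<exists>(H1 :: 'h1 set) A1 B1 C1 D1.
        unitary_colligation H1 E F A1 B1 C1 D1 \<and>
        (\<forall>n. \<forall>g\<in>G'. w n g = symbol_column G'' J H0 F A0 B0 C0 (io_map A1 B1 C1 D1) n g))"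

end

(* A lift Y corresponds to a unitary U extending V on a Hilbert space K containing H0: on the
   completion K of K'' + K' in the form with Gram matrix [I, Y; Y^*, I] take U = U''^* + U'^*, and
   conversely Y is recovered from the isometric embeddings Phi', Phi'' of K', K'' into K, which
   *-cyclicity provides, as Phi''^* Phi'. Such U, written with respect to K = H0 + H1, is exactly
   the closed loop of U_0 with a unitary colligation U_1 on H1, and w(n) is the compression of U^n;
   eliminating the signals of the loop gives the feedback formula.

   In order to find H1 inside K'' x K', the completion is realized as the closed range of
   (k'', k') |-> (k'' + Y k', Q k') with Q = (I - Y^*Y)^(1/2). *)

theory Submission
  imports Defs
begin

section \<open>Complex inner product spaces\<close>

text \<open>\<open>V\<close> acts like the adjoints of \<open>U''\<close> and \<open>U'\<close>, so
  the closed loop runs the adjoint dynamics forward in time. Negative indices need no loop: the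
  adjoint of \<open>A0\<close> shifts the copy of \<open>Kp\<close> inside \<open>H0\<close>, so
  that half of \<open>w\<close> is fixed by the data. Both implications therefore meet in one
  identity, for n >= 0, \<open>m\<close> in \<open>Km\<close>, \<open>k\<close> in
  \<open>Kp\<close>: after n steps from \<open>(J (0, k), 0)\<close> the \<open>H0\<close>-component
  of the loop pairs with \<open>J (m, 0)\<close> exactly as \<open>Y ((R' ^^ n) k)\<close> pairs
  with \<open>m\<close>, where \<open>R'\<close> is the adjoint of \<open>U'\<close>.

  From lift to colligation the obstacle is an ambient type for \<open>H1\<close> fixed in advance.
  The model with \<open>Q\<close> works because adding the squared norm of \<open>Q k'\<close> to
  that of \<open>k'' + Y k'\<close> trades the term of \<open>Y k'\<close> for that of
  \<open>k'\<close>, which leaves the Gram form. What is required of \<open>Q\<close> is just <Q x,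
  Q y> = <x, y> - <Y x, Y y>; a binomial series provides it, even at norm one, since its
  coefficients are absolutely summable.

  In the converse the embeddings are given only on \<open>Kp\<close> and \<open>Km\<close>, and must
  be extended along the loop, in opposite directions of time.\<close>

lemma cinner_add_right: "cinner x (y + z) = cinner x y + cinner x z"
  by (metis cinner_add_left cinner_commute complex_cnj_add)

lemma cinner_scaleC_right: "cinner x (c *\<^sub>C y) = cnj c * cinner x y"
  by (metis cinner_scaleC_left cinner_commute complex_cnj_mult)

lemma scaleC_one [simp]: "1 *\<^sub>C x = x"
  using scaleC_of_real[of 1 x] by simp

lemma scaleC_zero_left [simp]: "0 *\<^sub>C x = 0"
  using scaleC_of_real[of 0 x] by simp

lemma scaleC_minus_one: "(- 1) *\<^sub>C x = - x"
  using scaleC_of_real[of "-1" x] by simp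

lemma cinner_minus_left: "cinner (- x) y = - cinner x y"
  using cinner_scaleC_left[of "-1" x y] by (simp add: scaleC_minus_one)

lemma cinner_minus_right: "cinner x (- y) = - cinner x y"
  by (metis cinner_commute cinner_minus_left complex_cnj_minus)

lemma cinner_diff_left: "cinner (x - y) z = cinner x z - cinner y z"
  using cinner_add_left[of x "- y" z] by (simp add: cinner_minus_left)

lemma cinner_diff_right: "cinner x (y - z) = cinner x y - cinner x z"
  using cinner_add_right[of x y "- z"] by (simp add: cinner_minus_right)

lemma cinner_zero_left [simp]: "cinner 0 x = 0"
  using cinner_scaleC_left[of 0 0 x] by simp

lemma cinner_zero_right [simp]: "cinner x 0 = 0"
  using cinner_scaleC_right[of x 0 0] by simp

lemma cinner_scaleR_left: "cinner (r *\<^sub>R x) y = r *\<^sub>R cinner x y"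
  by (metis cinner_scaleC_left scaleC_of_real scaleR_conv_of_real)

lemma cinner_scaleR_right: "cinner x (r *\<^sub>R y) = r *\<^sub>R cinner x y"
  by (metis cinner_scaleC_right complex_cnj_complex_of_real scaleC_of_real scaleR_conv_of_real)

lemma cinner_self: "cinner x x = complex_of_real ((norm x)\<^sup>2)"
proof -
  have "Im (cinner x x) = 0"
    using arg_cong[OF cinner_commute[of x x], of Im] by simp
  then show ?thesis
    by (simp add: complex_eq_iff inner_eq_Re_cinner[symmetric] power2_norm_eq_inner)
qed

lemma cinner_self_eq_0 [simp]: "cinner x x = 0 \<longleftrightarrow> x = 0"
  by (simp add: cinner_self)

lemma cmod_cinner_self: "cmod (cinner x x) = (norm x)\<^sup>2"
  unfolding cinner_self norm_of_real by simp

lemma cinner_eqI: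
  assumes "\<And>z. cinner z x = cinner z y"
  shows "x = y"
  using assms[of "x - y"] cinner_self_eq_0[of "x - y"] by (simp add: cinner_diff_right)

lemma scaleC_zero_right [simp]: "c *\<^sub>C 0 = 0"
  using scaleC_scaleC[of c 0 0] by simp

lemma scaleC_minus_right: "c *\<^sub>C (- x) = - (c *\<^sub>C x)"
  by (metis mult.commute scaleC_minus_one scaleC_scaleC)

lemma scaleC_diff_right: "c *\<^sub>C (x - y) = c *\<^sub>C x - c *\<^sub>C y"
  using scaleC_add_right[of c x "- y"] by (simp add: scaleC_minus_right)

lemma scaleR_scaleC: "r *\<^sub>R (c *\<^sub>C x) = c *\<^sub>C (r *\<^sub>R x)"
  by (metis mult.commute scaleC_of_real scaleC_scaleC)

lemma norm_scaleC: "norm (c *\<^sub>C x) = cmod c * norm x"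
proof -
  have "complex_of_real ((norm (c *\<^sub>C x))\<^sup>2) = c * cnj c * cinner x x"
    unfolding cinner_self[symmetric] by (simp add: cinner_scaleC_left cinner_scaleC_right)
  also have "\<dots> = complex_of_real ((cmod c * norm x)\<^sup>2)"
    by (simp add: cinner_self complex_norm_square[symmetric] power_mult_distrib)
  finally have "(norm (c *\<^sub>C x))\<^sup>2 = (cmod c * norm x)\<^sup>2"
    using of_real_eq_iff by blast
  then show ?thesis by simp
qed

lemma bounded_linear_scaleC: "bounded_linear (\<lambda>x. c *\<^sub>C x)"
  by (rule bounded_linear_intro[where K = "cmod c"])
    (simp_all add: scaleC_add_right scaleR_scaleC norm_scaleC mult.commute)

text \<open>Rotating \<open>x\<close> so that the form becomes real reduces to the real Cauchy-Schwarz inequality.\<close>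

lemma norm_cinner_le: "cmod (cinner x y) \<le> norm x * norm y"
proof -
  define c where "c = cnj (sgn (cinner x y))"
  have "cinner (c *\<^sub>C x) y = complex_of_real (cmod (cinner x y))"
  proof (cases "cinner x y = 0")
    case False
    have "c * cinner x y = complex_of_real ((cmod (cinner x y))\<^sup>2) / of_real (cmod (cinner x y))"
      by (simp only: c_def sgn_div_norm complex_norm_square) (simp add: scaleR_conv_of_real field_simps)
    with False show ?thesis
      by (simp add: cinner_scaleC_left power2_eq_square)
  qed (simp add: c_def cinner_scaleC_left)
  then have "cmod (cinner x y) = (c *\<^sub>C x) \<bullet> y"
    by (simp add: inner_eq_Re_cinner)
  also have "\<dots> \<le> norm (c *\<^sub>C x) * norm y"
    by (rule norm_cauchy_schwarz)
  also have "\<dots> \<le> norm x * norm y"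
    by (auto simp: norm_scaleC c_def norm_sgn)
  finally show ?thesis .
qed

lemma bounded_bilinear_cinner: "bounded_bilinear cinner"
  by (rule bounded_bilinear.intro)
    (auto simp: cinner_add_left cinner_add_right cinner_scaleR_left cinner_scaleR_right
      intro!: exI[of _ 1] norm_cinner_le)

lemmas continuous_on_cinner [continuous_intros] =
  bounded_bilinear.continuous_on[OF bounded_bilinear_cinner]

lemma norm_eq_if_cinner_self_eq:
  assumes "cinner x x = cinner y y"
  shows "norm x = norm y"
proof -
  have "(norm x)\<^sup>2 = (norm y)\<^sup>2"
    using assms unfolding cinner_self of_real_eq_iff .
  then show ?thesis by simp
qed


section \<open>Subspaces and linear maps\<close>

text \<open>Closedness is split off because dense subspaces, such as the images of \<open>J\<close>
  and \<open>W\<close> or a union of backward translates, enter before their closures.\<close>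

definition csubspace :: "'a::complex_inner set \<Rightarrow> bool" where
  "csubspace S \<longleftrightarrow> 0 \<in> S \<and> (\<forall>x\<in>S. \<forall>y\<in>S. x + y \<in> S) \<and> (\<forall>c. \<forall>x\<in>S. c *\<^sub>C x \<in> S)"

lemma closed_csubspace_iff: "closed_csubspace S \<longleftrightarrow> csubspace S \<and> closed S"
  by (auto simp: closed_csubspace_def csubspace_def)

lemma csubspaceD:
  assumes "csubspace S"
  shows "0 \<in> S" "x \<in> S \<Longrightarrow> y \<in> S \<Longrightarrow> x + y \<in> S" "x \<in> S \<Longrightarrow> c *\<^sub>C x \<in> S"
    "x \<in> S \<Longrightarrow> - x \<in> S" "x \<in> S \<Longrightarrow> y \<in> S \<Longrightarrow> x - y \<in> S" "x \<in> S \<Longrightarrow> r *\<^sub>R x \<in> S"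
proof -
  show add: "x + y \<in> S" if "x \<in> S" "y \<in> S" for x y
    using assms that by (auto simp: csubspace_def)
  show scale: "c *\<^sub>C x \<in> S" if "x \<in> S" for c x
    using assms that by (auto simp: csubspace_def)
  show uminus: "- x \<in> S" if "x \<in> S" for x
    using scale[OF that, of "-1"] by (simp add: scaleC_minus_one)
  show "x - y \<in> S" if "x \<in> S" "y \<in> S"
    using add[OF that(1) uminus[OF that(2)]] by simp
  show "r *\<^sub>R x \<in> S" if "x \<in> S"
    using scale[OF that, of "of_real r"] by (simp add: scaleC_of_real)
  show "0 \<in> S"
    using assms by (simp add: csubspace_def)
qed

lemma csubspace_UNIV [simp]: "csubspace UNIV"
  by (simp add: csubspace_def)

lemma csubspace_Times: "csubspace S \<Longrightarrow> csubspace T \<Longrightarrow> csubspace (S \<times> T)"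
  by (auto simp: csubspace_def scaleC_prod_def zero_prod_def)

lemma closed_csubspace_Times: "closed_csubspace S \<Longrightarrow> closed_csubspace T \<Longrightarrow> closed_csubspace (S \<times> T)"
  by (simp add: closed_csubspace_iff csubspace_Times closed_Times)

lemma csubspace_sum: "csubspace S \<Longrightarrow> (\<And>i. i \<in> I \<Longrightarrow> f i \<in> S) \<Longrightarrow> (\<Sum>i\<in>I. f i) \<in> S"
  by (induction I rule: infinite_finite_induct) (auto simp: csubspaceD)

lemma closed_csubspace_closure:
  assumes "csubspace S"
  shows "closed_csubspace (closure S)"
  unfolding closed_csubspace_def
proof (intro conjI allI ballI)
  show "0 \<in> closure S"
    using csubspaceD(1)[OF assms] closure_subset by blast
next
  fix x y assume "x \<in> closure S" "y \<in> closure S"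
  then obtain f g where "\<forall>n. f n \<in> S" "f \<longlonglongrightarrow> x" "\<forall>n. g n \<in> S" "g \<longlonglongrightarrow> y"
    by (auto simp: closure_sequential)
  then show "x + y \<in> closure S"
    unfolding closure_sequential
    by (intro exI[of _ "\<lambda>n. f n + g n"]) (auto intro: tendsto_add csubspaceD[OF assms])
next
  fix c x assume "x \<in> closure S"
  then obtain f where "\<forall>n. f n \<in> S" "f \<longlonglongrightarrow> x"
    by (auto simp: closure_sequential)
  then show "c *\<^sub>C x \<in> closure S"
    unfolding closure_sequential
    by (intro exI[of _ "\<lambda>n. c *\<^sub>C f n"])
      (auto intro: bounded_linear.tendsto[OF bounded_linear_scaleC] csubspaceD[OF assms])
qed simp

lemma clinear_onD:
  assumes "clinear_on S f"
  shows "x \<in> S \<Longrightarrow> y \<in> S \<Longrightarrow> f (x + y) = f x + f y" "x \<in> S \<Longrightarrow> f (c *\<^sub>C x) = c *\<^sub>C f x"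
  using assms by (auto simp: clinear_on_def)

lemma clinear_on_zero: "clinear_on S f \<Longrightarrow> csubspace S \<Longrightarrow> f 0 = 0"
  using clinear_onD(2)[of S f 0 0] by (simp add: csubspaceD)

lemma clinear_on_minus: "clinear_on S f \<Longrightarrow> x \<in> S \<Longrightarrow> f (- x) = - f x"
  using clinear_onD(2)[of S f x "-1"] by (simp add: scaleC_minus_one)

lemma clinear_on_diff:
  assumes "clinear_on S f" "csubspace S" "x \<in> S" "y \<in> S"
  shows "f (x - y) = f x - f y"
  using clinear_onD(1)[OF assms(1) assms(3) csubspaceD(4)[OF assms(2,4)]]
  by (simp add: clinear_on_minus[OF assms(1,4)])

lemma clinear_on_sum:
  assumes "clinear_on S f" "csubspace S" "\<And>i. i \<in> I \<Longrightarrow> x i \<in> S"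
  shows "f (\<Sum>i\<in>I. x i) = (\<Sum>i\<in>I. f (x i))"
  using assms(3)
proof (induction I rule: infinite_finite_induct)
  case (insert i I)
  then show ?case
    by (simp add: clinear_onD(1)[OF assms(1)] csubspace_sum[OF assms(2)])
qed (use clinear_on_zero[OF assms(1,2)] in auto)

lemma clinear_on_subset: "clinear_on S f \<Longrightarrow> T \<subseteq> S \<Longrightarrow> clinear_on T f"
  unfolding clinear_on_def by blast

lemma clinear_on_compose:
  "clinear_on S f \<Longrightarrow> clinear_on T g \<Longrightarrow> f ` S \<subseteq> T \<Longrightarrow> clinear_on S (\<lambda>x. g (f x))"
  unfolding clinear_on_def by (auto simp: image_subset_iff)

lemma csubspace_image:
  assumes "clinear_on S f" "csubspace S"
  shows "csubspace (f ` S)"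
  unfolding csubspace_def
proof (intro conjI allI ballI)
  show "0 \<in> f ` S"
    using clinear_on_zero[OF assms] csubspaceD(1)[OF assms(2)] by (metis imageI)
qed (auto simp: clinear_onD[OF assms(1), symmetric] csubspaceD[OF assms(2)])

text \<open>Polarization: the norms of \<open>x\<close>, \<open>y\<close> and \<open>x + y\<close>
  give the real part, and replacing \<open>x\<close> by \<open>\<i> *\<^sub>C x\<close> gives the
  imaginary part.\<close>

lemma norm_preserving_imp_cinner:
  assumes f: "clinear_on S f" and g: "clinear_on S g" and S: "csubspace S"
    and eq: "\<And>x. x \<in> S \<Longrightarrow> norm (f x) = norm (g x)" and x: "x \<in> S" and y: "y \<in> S"
  shows "cinner (f x) (f y) = cinner (g x) (g y)"
proof -
  have *: "Re (cinner (f x) (f y)) = Re (cinner (g x) (g y))" if "x \<in> S" "y \<in> S" for x y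
    using eq[of "x + y"] eq[of x] eq[of y] that csubspaceD[OF S]
    by (simp add: clinear_onD[OF f] clinear_onD[OF g] inner_eq_Re_cinner[symmetric] dot_norm)
  have "Re (cinner (f (\<i> *\<^sub>C x)) (f y)) = Re (cinner (g (\<i> *\<^sub>C x)) (g y))"
    using * x y csubspaceD[OF S] by blast
  then have "Im (cinner (f x) (f y)) = Im (cinner (g x) (g y))"
    using x by (simp add: clinear_onD[OF f] clinear_onD[OF g] cinner_scaleC_left)
  with *[OF x y] show ?thesis
    by (simp add: complex_eq_iff)
qed


section \<open>Orthogonal projection and adjoints\<close>

text \<open>A minimizing sequence for the distance to \<open>S\<close> is Cauchy by the
  parallelogram law, and a variation at its limit gives orthogonality.\<close>

lemma orthogonal_projection_ex:
  fixes x :: "'a::chilbert_space"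
  assumes S: "closed_csubspace S"
  shows "\<exists>p\<in>S. \<forall>s\<in>S. cinner (x - p) s = 0"
proof -
  have sub: "csubspace S" and cl: "closed S"
    using S by (auto simp: closed_csubspace_iff)
  note subD = csubspaceD[OF sub]
  define d where "d = infdist x S"
  have ne: "S \<noteq> {}" using subD(1) by auto
  have d_le: "d \<le> norm (x - s)" if "s \<in> S" for s
    using infdist_le[OF that, of x] by (simp add: d_def dist_norm)
  have d0: "0 \<le> d" by (simp add: d_def infdist_nonneg)
  have "\<exists>s\<in>S. norm (x - s) < d + 1 / Suc n" for n
  proof -
    have "bdd_below (dist x ` S)"
      by (rule bdd_belowI2[of _ 0]) simp
    then show ?thesis
      using cINF_less_iff[OF ne, of "dist x" "d + 1 / Suc n"] ne
      by (auto simp: d_def infdist_notempty dist_norm)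
  qed
  then obtain s where sS: "\<And>n. s n \<in> S" and s: "\<And>n. norm (x - s n) < d + 1 / Suc n"
    by metis
  have lim: "(\<lambda>n. (norm (x - s n))\<^sup>2) \<longlonglongrightarrow> d\<^sup>2"
  proof (intro tendsto_power real_tendsto_sandwich[of "\<lambda>_. d" "\<lambda>n. norm (x - s n)" _ "\<lambda>n. d + 1 / Suc n"])
    show "(\<lambda>n. d + 1 / Suc n) \<longlonglongrightarrow> d"
      using tendsto_add[OF tendsto_const[of d] LIMSEQ_inverse_real_of_nat]
      by (simp add: divide_inverse)
  qed (use less_imp_le[OF s] in \<open>auto intro!: always_eventually d_le sS\<close>)
  \<comment> \<open>Parallelogram law; the midpoint of \<open>s m\<close> and \<open>s n\<close>
    lies in \<open>S\<close>, hence at distance at least \<open>d\<close> from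
    \<open>x\<close>.\<close>
  have par: "(norm (s m - s n))\<^sup>2 \<le> 2 * ((norm (x - s m))\<^sup>2 - d\<^sup>2) + 2 * ((norm (x - s n))\<^sup>2 - d\<^sup>2)" for m n
  proof -
    have "d \<le> norm (x - (1/2) *\<^sub>R (s m + s n))"
      by (intro d_le subD sS)
    then have "d\<^sup>2 \<le> (norm (x - (1/2) *\<^sub>R (s m + s n)))\<^sup>2"
      by (rule power_mono) (rule d0)
    then show ?thesis
      by (simp add: power2_norm_eq_inner algebra_simps inner_commute)
  qed
  have "Cauchy s"
  proof (rule metric_CauchyI)
    fix e :: real assume e: "0 < e"
    have "\<forall>\<^sub>F n in sequentially. (norm (x - s n))\<^sup>2 < d\<^sup>2 + e\<^sup>2 / 4"
      by (rule order_tendstoD(2)[OF lim]) (use e in auto)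
    then obtain N where N: "\<And>n. n \<ge> N \<Longrightarrow> (norm (x - s n))\<^sup>2 < d\<^sup>2 + e\<^sup>2 / 4"
      by (auto simp: eventually_sequentially)
    show "\<exists>M. \<forall>m\<ge>M. \<forall>n\<ge>M. dist (s m) (s n) < e"
    proof (intro exI allI impI)
      fix m n assume "m \<ge> N" "n \<ge> N"
      then have "(norm (s m - s n))\<^sup>2 < e\<^sup>2"
        using par[of m n] N[of m] N[of n] by simp
      then show "dist (s m) (s n) < e"
        using e by (simp add: dist_norm power2_less_imp_less)
    qed
  qed
  then obtain p where p: "s \<longlonglongrightarrow> p"
    using Cauchy_convergent convergent_def by blast
  have pS: "p \<in> S"
    using closed_sequentially[OF cl _ p] sS by blast
  have "(\<lambda>n. (norm (x - s n))\<^sup>2) \<longlonglongrightarrow> (norm (x - p))\<^sup>2"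
    by (intro tendsto_intros p)
  with lim have pd: "(norm (x - p))\<^sup>2 = d\<^sup>2"
    using LIMSEQ_unique by blast
  have re: "(x - p) \<bullet> t = 0" if t: "t \<in> S" for t
  proof (cases "t = 0")
    case False
    \<comment> \<open>The multiple of \<open>t\<close> that brings \<open>p\<close> closest to
      \<open>x\<close>; the gain \<open>((x - p) \<bullet> t)\<^sup>2 / (t \<bullet> t)\<close> in
      squared distance cannot be positive.\<close>
    define r where "r = ((x - p) \<bullet> t) / (t \<bullet> t)"
    have "d \<le> norm (x - (p + r *\<^sub>R t))"
      by (intro d_le subD pS t)
    then have "d\<^sup>2 \<le> (norm (x - (p + r *\<^sub>R t)))\<^sup>2"
      by (rule power_mono) (rule d0)
    also have "\<dots> = (norm (x - p))\<^sup>2 - 2 * r * ((x - p) \<bullet> t) + r\<^sup>2 * (t \<bullet> t)"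
      unfolding diff_diff_eq[symmetric] power2_norm_eq_inner
      by (simp add: inner_diff inner_commute power2_eq_square)
    also have "\<dots> = d\<^sup>2 - ((x - p) \<bullet> t)\<^sup>2 / (t \<bullet> t)"
      unfolding pd using False by (simp add: r_def field_simps power2_eq_square)
    finally have "((x - p) \<bullet> t)\<^sup>2 / (t \<bullet> t) \<le> 0" by simp
    then show ?thesis
      using False by (auto simp: divide_le_0_iff dest: order.antisym[OF _ inner_ge_zero])
  qed simp
  show ?thesis
  proof (intro bexI[OF _ pS] ballI)
    fix t assume t: "t \<in> S"
    have "Im (cinner (x - p) t) = Re (cinner (x - p) (\<i> *\<^sub>C t))"
      by (simp add: cinner_scaleC_right)
    then show "cinner (x - p) t = 0"
      using re[OF t] re[OF subD(3)[OF t, of \<i>]] by (simp add: complex_eq_iff inner_eq_Re_cinner)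
  qed
qed

text \<open>Settles the definite description in \<open>proj\<close>: two candidates differ by a
  vector of \<open>S\<close> that is orthogonal to itself.\<close>

lemma proj_eqI:
  assumes "csubspace S" "p \<in> S" "\<And>s. s \<in> S \<Longrightarrow> cinner (x - p) s = 0"
  shows "proj S x = p"
  unfolding proj_def
proof (rule the_equality)
  fix q assume q: "q \<in> S \<and> (\<forall>s\<in>S. cinner (x - q) s = 0)"
  then have mem: "p - q \<in> S"
    using assms by (auto intro: csubspaceD)
  have "cinner (p - q) (p - q) = cinner (x - q) (p - q) - cinner (x - p) (p - q)"
    by (simp add: cinner_diff_left)
  also have "\<dots> = 0" using q assms mem by simp
  finally show "q = p" by simp
qed (use assms in auto)

lemma
  fixes x :: "'a::chilbert_space"
  assumes S: "closed_csubspace S"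
  shows proj_mem: "proj S x \<in> S"
    and proj_orth: "s \<in> S \<Longrightarrow> cinner (x - proj S x) s = 0"
    and cinner_proj: "s \<in> S \<Longrightarrow> cinner (proj S x) s = cinner x s"
    and cinner_proj': "s \<in> S \<Longrightarrow> cinner s (proj S x) = cinner s x"
proof -
  have sub: "csubspace S" using S by (simp add: closed_csubspace_iff)
  obtain p where p: "p \<in> S" "\<forall>s\<in>S. cinner (x - p) s = 0"
    using orthogonal_projection_ex[OF S] by blast
  then have eq: "proj S x = p"
    by (intro proj_eqI sub) auto
  show "proj S x \<in> S" using p eq by simp
  show orth: "cinner (x - proj S x) s = 0" if "s \<in> S" for s using p eq that by simp
  show *: "cinner (proj S x) s = cinner x s" if "s \<in> S" for s
    using orth[OF that] by (simp add: cinner_diff_left)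
  show "cinner s (proj S x) = cinner s x" if "s \<in> S" for s
    using *[OF that] by (metis cinner_commute)
qed

lemma proj_same: "csubspace S \<Longrightarrow> x \<in> S \<Longrightarrow> proj S x = x"
  by (rule proj_eqI) auto

lemma clinear_on_proj:
  fixes S :: "'a::chilbert_space set"
  assumes "closed_csubspace S"
  shows "clinear_on T (proj S)"
proof -
  have sub: "csubspace S" using assms by (simp add: closed_csubspace_iff)
  note mem = proj_mem[OF assms] and orth = proj_orth[OF assms]
  show ?thesis
    unfolding clinear_on_def
  proof (intro conjI allI ballI)
    fix x y
    show "proj S (x + y) = proj S x + proj S y"
    proof (rule proj_eqI[OF sub])
      fix s assume "s \<in> S"
      then show "cinner (x + y - (proj S x + proj S y)) s = 0"
        using orth[of s x] orth[of s y] by (simp add: cinner_diff_left cinner_add_left)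
    qed (simp add: mem csubspaceD[OF sub])
    fix c
    show "proj S (c *\<^sub>C x) = c *\<^sub>C proj S x"
    proof (rule proj_eqI[OF sub])
      fix s assume "s \<in> S"
      then show "cinner (c *\<^sub>C x - c *\<^sub>C proj S x) s = 0"
        using orth[of s x] by (simp add: scaleC_diff_right[symmetric] cinner_scaleC_left)
    qed (simp add: mem csubspaceD[OF sub])
  qed
qed

lemma norm_proj_le:
  fixes S :: "'a::chilbert_space set"
  assumes "closed_csubspace S"
  shows "norm (proj S x) \<le> norm x"
proof -
  have "(norm (proj S x))\<^sup>2 = cmod (cinner (proj S x) (proj S x))"
    by (rule cmod_cinner_self[symmetric])
  also have "\<dots> = cmod (cinner x (proj S x))"
    by (simp only: cinner_proj[OF assms proj_mem[OF assms]])
  also have "\<dots> \<le> norm x * norm (proj S x)"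
    by (rule norm_cinner_le)
  finally have "norm (proj S x) * norm (proj S x) \<le> norm x * norm (proj S x)"
    by (simp add: power2_eq_square)
  then show ?thesis
    by (cases "proj S x = 0") (simp_all add: mult_le_cancel_right)
qed

lemma closed_csubspace_ominus:
  assumes "closed_csubspace S"
  shows "closed_csubspace (ominus S T)"
proof -
  have "{x. \<forall>t\<in>T. cinner x t = 0} = (\<Inter>t\<in>T. {x. cinner x t = 0})"
    by auto
  moreover have "closed (\<Inter>t\<in>T. {x. cinner x t = 0})"
    by (intro closed_INT ballI closed_Collect_eq continuous_intros)
  ultimately have "closed (S \<inter> {x. \<forall>t\<in>T. cinner x t = 0})"
    using assms by (auto simp: closed_csubspace_iff)
  also have "S \<inter> {x. \<forall>t\<in>T. cinner x t = 0} = ominus S T"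
    by (auto simp: ominus_def)
  finally show ?thesis
    using assms by (auto simp: closed_csubspace_def ominus_def cinner_add_left cinner_scaleC_left)
qed

lemma diff_proj_mem_ominus:
  fixes S :: "'a::chilbert_space set"
  assumes "closed_csubspace S" "closed_csubspace T" "S \<subseteq> T" "x \<in> T"
  shows "x - proj S x \<in> ominus T S"
  using assms proj_mem[OF assms(1), of x] proj_orth[OF assms(1)]
  by (auto simp: ominus_def closed_csubspace_iff intro!: csubspaceD)

text \<open>Adjoints are computed by exhibiting a candidate; uniqueness follows as for
  projections.\<close>

lemma hadjoint_eqI:
  assumes "csubspace S" "x \<in> S" "\<And>z. z \<in> S \<Longrightarrow> cinner (f z) y = cinner z x"
  shows "hadjoint S f y = x"
  unfolding hadjoint_def
proof (rule the_equality)
  fix q assume q: "q \<in> S \<and> (\<forall>z\<in>S. cinner (f z) y = cinner z q)"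
  then have mem: "q - x \<in> S"
    using assms by (auto intro: csubspaceD)
  have "cinner (q - x) (q - x) = cinner (q - x) q - cinner (q - x) x"
    by (simp add: cinner_diff_right)
  also have "\<dots> = 0" using q assms(3)[OF mem] mem by simp
  finally show "q = x" by simp
qed (use assms in auto)

text \<open>Both definite descriptions have the same predicate, so no existence question arises.
  This is how compressions along different embeddings, at vectors of different spaces, are
  compared.\<close>

lemma hadjoint_cong:
  "(\<And>z. z \<in> S \<Longrightarrow> cinner (f z) y = cinner (g z) y') \<Longrightarrow> hadjoint S f y = hadjoint S g y'"
  unfolding hadjoint_def by (rule arg_cong[where f = The]) auto

lemma clinear_bounded_continuous_on:
  assumes "clinear_on S f" "csubspace S" "\<And>x. x \<in> S \<Longrightarrow> norm (f x) \<le> M * norm x"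
  shows "continuous_on S f"
proof (rule continuous_onI)
  fix x e assume x: "x \<in> S" and e: "(0::real) < e"
  show "\<exists>d>0. \<forall>x'\<in>S. dist x' x < d \<longrightarrow> dist (f x') (f x) \<le> e"
  proof (intro exI[of _ "e / (\<bar>M\<bar> + 1)"] conjI ballI impI)
    fix y assume y: "y \<in> S" "dist y x < e / (\<bar>M\<bar> + 1)"
    have "norm (f y - f x) \<le> M * norm (y - x)"
      using assms(3)[of "y - x"] x y csubspaceD[OF assms(2)]
      by (simp add: clinear_on_diff[OF assms(1,2)])
    also have "\<dots> \<le> (\<bar>M\<bar> + 1) * norm (y - x)"
      by (intro mult_right_mono) auto
    also have "\<dots> \<le> e"
      using y(2) by (simp add: dist_norm field_simps)
    finally show "dist (f y) (f x) \<le> e" by (simp add: dist_norm)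
  qed (use e in auto)
qed

text \<open>The kernel \<open>N\<close> is closed and of codimension one in \<open>S\<close>, so the
  part \<open>v\<close> of \<open>u\<close> orthogonal to \<open>N\<close> represents
  \<open>f\<close> up to a scalar.\<close>

lemma riesz_representation:
  fixes S :: "'a::chilbert_space set" and f :: "'a \<Rightarrow> complex"
  assumes S: "closed_csubspace S" and f: "clinear_on S f"
    and bd: "\<And>x. x \<in> S \<Longrightarrow> cmod (f x) \<le> M * norm x"
  shows "\<exists>x\<in>S. \<forall>z\<in>S. f z = cinner z x"
proof (cases "\<forall>z\<in>S. f z = 0")
  case True
  then show ?thesis
    using S by (intro bexI[of _ 0]) (auto simp: closed_csubspace_def)
next
  case False
  then obtain u where u: "u \<in> S" "f u \<noteq> 0" by blast
  have sub: "csubspace S" and cl: "closed S"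
    using S by (auto simp: closed_csubspace_iff)
  note subD = csubspaceD[OF sub]
  define N where "N = {z \<in> S. f z = 0}"
  have "continuous_on S f"
    using clinear_bounded_continuous_on[OF f sub bd] .
  then have "closed N"
    unfolding N_def using continuous_closed_preimage_constant[OF _ cl] by blast
  then have N: "closed_csubspace N"
    using subD clinear_on_zero[OF f sub]
    by (auto simp: closed_csubspace_iff csubspace_def N_def clinear_onD[OF f])
  define v where "v = u - proj N u"
  have pN: "proj N u \<in> N" by (rule proj_mem[OF N])
  then have vS: "v \<in> S"
    using u subD by (auto simp: v_def N_def)
  have fv: "f v = f u"
    using pN u by (simp add: v_def clinear_on_diff[OF f sub] N_def)
  then have v0: "v \<noteq> 0"
    using u clinear_on_zero[OF f sub] by auto
  \<comment> \<open>Scaled so that \<open>v\<close> paired with \<open>c *\<^sub>C v\<close> gives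
    \<open>f v\<close>; conjugated because the form is antilinear in its second argument.\<close>
  define c where "c = cnj (f v) / cinner v v"
  have "f z = cinner z (c *\<^sub>C v)" if z: "z \<in> S" for z
  proof -
    define n where "n = z - (f z / f v) *\<^sub>C v"
    have "n \<in> N"
      using z vS u fv subD
      by (simp add: N_def n_def clinear_on_diff[OF f sub] clinear_onD[OF f] scaleC_complex_def)
    then have "cinner v n = 0"
      unfolding v_def by (rule proj_orth[OF N])
    then have "cinner n v = 0"
      by (metis cinner_commute complex_cnj_zero)
    then have "cinner z v = (f z / f v) * cinner v v"
      by (simp add: n_def cinner_diff_left cinner_scaleC_left)
    then show ?thesis
      using u fv v0 by (simp add: c_def cinner_scaleC_right cinner_commute[of v v, symmetric])
  qed
  then show ?thesis
    using subD(3)[OF vS] by blast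
qed

lemma cinner_hadjoint:
  fixes S :: "'a::chilbert_space set" and f :: "'a \<Rightarrow> 'b::complex_inner"
  assumes S: "closed_csubspace S" and f: "clinear_on S f"
    and bd: "\<And>x. x \<in> S \<Longrightarrow> norm (f x) \<le> M * norm x"
    and z: "z \<in> S"
  shows "cinner z (hadjoint S f y) = cinner (f z) y"
proof -
  have sub: "csubspace S" using S by (simp add: closed_csubspace_iff)
  have "\<exists>x\<in>S. \<forall>z\<in>S. cinner (f z) y = cinner z x"
  proof (rule riesz_representation[OF S, where M = "M * norm y"])
    show "clinear_on S (\<lambda>z. cinner (f z) y)"
      by (auto simp: clinear_on_def clinear_onD[OF f] cinner_add_left cinner_scaleC_left scaleC_complex_def)
    fix x assume "x \<in> S"
    then have "norm (f x) * norm y \<le> (M * norm x) * norm y"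
      by (intro mult_right_mono bd) auto
    then show "cmod (cinner (f x) y) \<le> M * norm y * norm x"
      using norm_cinner_le[of "f x" y] by (simp add: mult_ac)
  qed
  then obtain x where x: "x \<in> S" "\<forall>z\<in>S. cinner (f z) y = cinner z x" by blast
  then have "hadjoint S f y = x"
    by (intro hadjoint_eqI sub) auto
  with x z show ?thesis
    by auto
qed


section \<open>Unitary operators\<close>

lemma unitary_opD:
  assumes "unitary_op S T f"
  shows "clinear_on S f" "x \<in> S \<Longrightarrow> f x \<in> T" "y \<in> T \<Longrightarrow> \<exists>x\<in>S. f x = y"
    "x \<in> S \<Longrightarrow> x' \<in> S \<Longrightarrow> cinner (f x) (f x') = cinner x x'"
    "x \<in> S \<Longrightarrow> norm (f x) = norm x"
  using assms by (auto simp: unitary_op_def intro!: norm_eq_if_cinner_self_eq)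

lemma unitary_op_compose:
  assumes f: "unitary_op S T f" and g: "unitary_op T R g"
  shows "unitary_op S R (\<lambda>x. g (f x))"
proof -
  have "(\<lambda>x. g (f x)) ` S = g ` (f ` S)" by auto
  then show ?thesis
    using f g clinear_on_compose[of S f T g]
    by (auto simp: unitary_op_def)
qed

text \<open>At \<open>f x\<close> the vector \<open>x\<close> has the defining property of the
  adjoint, because \<open>f\<close> preserves the form. So the adjoint is the inverse, and
  surjectivity transfers the rest.\<close>

lemma
  assumes f: "unitary_op S T f" and S: "csubspace S"
  shows hadjoint_unitary_apply: "x \<in> S \<Longrightarrow> hadjoint S f (f x) = x"
    and hadjoint_unitary_mem: "y \<in> T \<Longrightarrow> hadjoint S f y \<in> S"
    and unitary_apply_hadjoint: "y \<in> T \<Longrightarrow> f (hadjoint S f y) = y"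
    and unitary_op_hadjoint: "unitary_op T S (hadjoint S f)"
proof -
  note D = unitary_opD[OF f]
  show app: "hadjoint S f (f x) = x" if "x \<in> S" for x
    by (rule hadjoint_eqI[OF S that]) (simp add: D that)
  show mem: "hadjoint S f y \<in> S" and inv: "f (hadjoint S f y) = y" if "y \<in> T" for y
    using D(3)[OF that] app by auto
  have T: "csubspace T"
    using csubspace_image[OF D(1) S] f by (simp add: unitary_op_def)
  have inj: "x = x'" if "x \<in> S" "x' \<in> S" "f x = f x'" for x x'
    using app that by metis
  show "unitary_op T S (hadjoint S f)"
    unfolding unitary_op_def clinear_on_def
  proof (intro conjI ballI allI)
    fix x y assume "x \<in> T" "y \<in> T"
    then show "hadjoint S f (x + y) = hadjoint S f x + hadjoint S f y"
      by (intro inj) (simp_all add: mem inv csubspaceD[OF S] csubspaceD[OF T] clinear_onD[OF D(1)])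
  next
    fix c x assume "x \<in> T"
    then show "hadjoint S f (c *\<^sub>C x) = c *\<^sub>C hadjoint S f x"
      by (intro inj) (simp_all add: mem inv csubspaceD[OF S] csubspaceD[OF T] clinear_onD[OF D(1)])
  next
    show "hadjoint S f ` T = S"
      using mem app D(2) by force
  next
    fix x y assume "x \<in> T" "y \<in> T"
    then show "cinner (hadjoint S f x) (hadjoint S f y) = cinner x y"
      using D(4)[OF mem mem] by (simp add: inv)
  qed
qed

lemma unitary_adjoint:
  assumes "unitary_op UNIV UNIV U"
  shows "cinner (U x) y = cinner x (hadjoint UNIV U y)"
    and "cinner x (U y) = cinner (hadjoint UNIV U x) y"
    and "hadjoint UNIV (hadjoint UNIV U) = U"
proof -
  let ?V = "hadjoint UNIV U"
  note inv = unitary_apply_hadjoint[OF assms csubspace_UNIV UNIV_I]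
  note V = unitary_op_hadjoint[OF assms csubspace_UNIV]
  show "cinner (U x) y = cinner x (?V y)" for x y
    using unitary_opD(4)[OF assms UNIV_I UNIV_I, of x "?V y"] by (simp add: inv)
  show "cinner x (U y) = cinner (?V x) y" for x y
    using unitary_opD(4)[OF assms UNIV_I UNIV_I, of "?V x" y] by (simp add: inv)
  show "hadjoint UNIV ?V = U"
  proof
    fix y
    show "hadjoint UNIV ?V y = U y"
      using hadjoint_unitary_apply[OF V csubspace_UNIV, of "U y"]
      by (simp add: hadjoint_unitary_apply[OF assms csubspace_UNIV])
  qed
qed

lemma unitary_op_funpow:
  assumes "unitary_op S S f"
  shows "unitary_op S S (f ^^ n)"
proof (induction n)
  case 0
  show ?case by (auto simp: unitary_op_def clinear_on_def)
next
  case (Suc n)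
  then show ?case
    using unitary_op_compose[OF Suc.IH assms] by (simp add: o_def)
qed

lemma unitary_continuous_on:
  "unitary_op S T f \<Longrightarrow> csubspace S \<Longrightarrow> continuous_on S f"
  using clinear_bounded_continuous_on[of S f 1] unitary_opD(1,5)[of S T f] by auto

lemma clinear_isometry_imp_unitary:
  assumes f: "clinear_on S f" and S: "csubspace S" and iso: "\<And>x. x \<in> S \<Longrightarrow> norm (f x) = norm x"
  shows "unitary_op S (f ` S) f"
  using norm_preserving_imp_cinner[OF f _ S, of "\<lambda>x. x"] f iso
  by (auto simp: unitary_op_def clinear_on_def)

text \<open>A convergent sequence in \<open>T\<close> pulls back isometrically to a Cauchy sequence
  in \<open>S\<close>, and the image of its limit is the limit sought.\<close>

lemma closed_unitary_image:
  fixes S :: "'a::chilbert_space set"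
  assumes S: "closed_csubspace S" and f: "unitary_op S T f"
  shows "closed_csubspace T"
proof -
  have sub: "csubspace S" and cl: "closed S"
    using S by (auto simp: closed_csubspace_iff)
  note D = unitary_opD[OF f]
  have T: "csubspace T"
    using csubspace_image[OF D(1) sub] f by (simp add: unitary_op_def)
  have "closed T"
    unfolding closed_sequential_limits
  proof (intro allI impI)
    fix y l assume y: "(\<forall>n. y n \<in> T) \<and> y \<longlonglongrightarrow> l"
    then have "\<forall>n. \<exists>x. x \<in> S \<and> f x = y n"
      using D(3) by blast
    then obtain x where x: "\<And>n. x n \<in> S" "\<And>n. f (x n) = y n"
      by (auto simp: choice_iff)
    have d: "dist (x m) (x n) = dist (y m) (y n)" for m n
      using D(5)[of "x m - x n"] csubspaceD(5)[OF sub] x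
      by (simp add: dist_norm clinear_on_diff[OF D(1) sub])
    have "Cauchy y"
      using y LIMSEQ_imp_Cauchy by blast
    then have "Cauchy x"
      by (simp add: Cauchy_def d)
    then obtain p where p: "x \<longlonglongrightarrow> p"
      using Cauchy_convergent convergent_def by blast
    then have pS: "p \<in> S"
      using closed_sequentially[OF cl _ p] x by blast
    have "(\<lambda>n. f (x n)) \<longlonglongrightarrow> f p"
      by (rule continuous_on_tendsto_compose[OF unitary_continuous_on[OF f sub] p pS])
        (simp add: x(1))
    then have "y \<longlonglongrightarrow> f p"
      by (simp add: x(2))
    then have "f p = l"
      using y LIMSEQ_unique by blast
    then show "l \<in> T"
      using D(2)[OF pS] by simp
  qed
  with T show ?thesis by (simp add: closed_csubspace_iff)
qed

text \<open>\<open>g\<close> after the inverse of \<open>f\<close> is well defined and isometric on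
  the image of \<open>f\<close>, and extends by uniform continuity. The same device yields
  \<open>V\<close>, the dilation \<open>U\<close>, the embedding \<open>\<iota>\<close> and the
  star-cyclic extension \<open>\<Phi>\<close>.\<close>

lemma unitary_between_closures:
  fixes f :: "'m::complex_inner \<Rightarrow> 'a::chilbert_space" and g :: "'m \<Rightarrow> 'b::chilbert_space"
  assumes M: "csubspace M" and f: "clinear_on M f" and g: "clinear_on M g"
    and eq: "\<And>x. x \<in> M \<Longrightarrow> norm (f x) = norm (g x)"
  shows "\<exists>V. unitary_op (closure (f ` M)) (closure (g ` M)) V \<and> (\<forall>x\<in>M. V (f x) = g x)"
proof -
  define T where "T y = g (SOME x. x \<in> M \<and> f x = y)" for y
  have Tf: "T (f x) = g x" if "x \<in> M" for x
  proof -
    define x' where "x' = (SOME x'. x' \<in> M \<and> f x' = f x)"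
    have x': "x' \<in> M" "f x' = f x"
      using someI[of "\<lambda>x'. x' \<in> M \<and> f x' = f x" x] that by (auto simp: x'_def)
    \<comment> \<open>Equal norms send the difference of two preimages to 0, so the choice made in
      \<open>T\<close> is immaterial.\<close>
    have "norm (g (x' - x)) = norm (f (x' - x))"
      using eq[of "x' - x"] that x' csubspaceD(5)[OF M] by simp
    also have "\<dots> = 0"
      using that x' by (simp add: clinear_on_diff[OF f M])
    finally show ?thesis
      using that x' by (simp add: clinear_on_diff[OF g M] T_def x'_def[symmetric])
  qed
  have lin: "clinear_on (f ` M) T"
    unfolding clinear_on_def
    by (auto simp: clinear_onD[OF f, symmetric] Tf csubspaceD[OF M] clinear_onD[OF g])
  have iso: "dist (T y) (T y') = dist y y'" if "y \<in> f ` M" "y' \<in> f ` M" for y y'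
  proof -
    from that obtain x x' where *: "x \<in> M" "x' \<in> M" "y = f x" "y' = f x'" by blast
    then show ?thesis
      using eq[of "x - x'"] csubspaceD(5)[OF M]
      by (simp add: dist_norm Tf clinear_on_diff[OF f M] clinear_on_diff[OF g M])
  qed
  have "uniformly_continuous_on (f ` M) T"
    unfolding uniformly_continuous_on_def using iso by auto
  then obtain V where V: "uniformly_continuous_on (closure (f ` M)) V" "\<And>x. x \<in> f ` M \<Longrightarrow> T x = V x"
    using uniformly_continuous_on_extension_on_closure by metis
  have Vf: "V (f x) = g x" if "x \<in> M" for x
    using V(2)[of "f x"] Tf that by simp
  have cont: "continuous_on (closure (f ` M)) V"
    using V(1) uniformly_continuous_imp_continuous by blast
  have lim: "(\<lambda>n. V (s n)) \<longlonglongrightarrow> V x" if "s \<longlonglongrightarrow> x" "\<forall>n. s n \<in> f ` M" for s x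
  proof (rule continuous_on_tendsto_compose[OF cont that(1)])
    show "x \<in> closure (f ` M)"
      using that by (auto simp: closure_sequential)
    show "\<forall>\<^sub>F n in sequentially. s n \<in> closure (f ` M)"
      using that(2) by (auto intro!: always_eventually subsetD[OF closure_subset])
  qed
  note fM = csubspace_image[OF f M]
  have C: "closed_csubspace (closure (f ` M))" "csubspace (closure (f ` M))"
    using closed_csubspace_closure[OF fM] by (auto simp: closed_csubspace_iff)
  have Vlin: "clinear_on (closure (f ` M)) V"
    unfolding clinear_on_def
  proof (intro conjI ballI allI)
    fix x y assume "x \<in> closure (f ` M)" "y \<in> closure (f ` M)"
    then obtain s t where s: "\<forall>n. s n \<in> f ` M" "s \<longlonglongrightarrow> x" "\<forall>n. t n \<in> f ` M" "t \<longlonglongrightarrow> y"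
      by (auto simp: closure_sequential)
    have "(\<lambda>n. V (s n + t n)) \<longlonglongrightarrow> V (x + y)"
      using s csubspaceD(2)[OF fM] by (intro lim tendsto_add) auto
    moreover have "V (s n + t n) = V (s n) + V (t n)" for n
      using s csubspaceD(2)[OF fM] clinear_onD(1)[OF lin] V(2) by metis
    moreover have "(\<lambda>n. V (s n) + V (t n)) \<longlonglongrightarrow> V x + V y"
      using s by (intro lim tendsto_add) auto
    ultimately show "V (x + y) = V x + V y"
      using LIMSEQ_unique by simp
  next
    fix c x assume "x \<in> closure (f ` M)"
    then obtain s where s: "\<forall>n. s n \<in> f ` M" "s \<longlonglongrightarrow> x"
      by (auto simp: closure_sequential)
    have "(\<lambda>n. V (c *\<^sub>C s n)) \<longlonglongrightarrow> V (c *\<^sub>C x)"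
      using s csubspaceD(3)[OF fM]
      by (intro lim bounded_linear.tendsto[OF bounded_linear_scaleC]) auto
    moreover have "V (c *\<^sub>C s n) = c *\<^sub>C V (s n)" for n
      using s csubspaceD(3)[OF fM] clinear_onD(2)[OF lin] V(2) by metis
    moreover have "(\<lambda>n. c *\<^sub>C V (s n)) \<longlonglongrightarrow> c *\<^sub>C V x"
      using s by (intro lim bounded_linear.tendsto[OF bounded_linear_scaleC]) auto
    ultimately show "V (c *\<^sub>C x) = c *\<^sub>C V x"
      using LIMSEQ_unique by simp
  qed
  have Viso: "norm (V x) = norm x" if x: "x \<in> closure (f ` M)" for x
  proof -
    from x obtain s where s: "\<forall>n. s n \<in> f ` M" "s \<longlonglongrightarrow> x"
      by (auto simp: closure_sequential)
    have "norm (V (s n)) = norm (s n)" for n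
    proof -
      obtain z where "z \<in> M" "s n = f z" using s by blast
      then show ?thesis using Vf eq by simp
    qed
    then show ?thesis
      using tendsto_norm[OF lim[OF s(2,1)]] tendsto_norm[OF s(2)] LIMSEQ_unique by simp
  qed
  have uV: "unitary_op (closure (f ` M)) (V ` closure (f ` M)) V"
    by (rule clinear_isometry_imp_unitary[OF Vlin C(2) Viso])
  have "V ` closure (f ` M) = closure (g ` M)"
  proof
    have "V ` f ` M \<subseteq> g ` M"
      using Vf by auto
    then have "V ` f ` M \<subseteq> closure (g ` M)"
      using closure_subset by (rule order.trans)
    with cont show "V ` closure (f ` M) \<subseteq> closure (g ` M)"
      by (intro image_closure_subset closed_closure)
    \<comment> \<open>Surjectivity: the isometric image of a closed subspace is closed, and it
      contains every \<open>g x\<close>.\<close>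
    have "g ` M \<subseteq> V ` closure (f ` M)"
    proof (rule image_subsetI)
      fix x assume x: "x \<in> M"
      have "f x \<in> closure (f ` M)"
        by (rule subsetD[OF closure_subset imageI[OF x]])
      then have "V (f x) \<in> V ` closure (f ` M)"
        by (rule imageI)
      then show "g x \<in> V ` closure (f ` M)"
        by (simp only: Vf[OF x])
    qed
    then show "closure (g ` M) \<subseteq> V ` closure (f ` M)"
      using closed_unitary_image[OF C(1) uV] by (intro closure_minimal) (simp_all add: closed_csubspace_iff)
  qed
  with uV Vf show ?thesis by auto
qed

text \<open>On the dense union of the spaces \<open>R\<^sup>-\<^sup>n K\<close> the isometry is forced to be
  \<open>W\<^sup>n j R\<^sup>n\<close>.\<close>

lemma star_cyclic_isometry_extension:
  fixes R :: "'a::chilbert_space \<Rightarrow> 'a" and W :: "'b::chilbert_space \<Rightarrow> 'b"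
  assumes R: "unitary_op UNIV UNIV R" and K: "csubspace K" and RK: "R ` K \<subseteq> K"
    and cyc: "star_cyclic R K"
    and S: "closed_csubspace S" and W: "unitary_op S S W"
    and j: "clinear_on K j" "j ` K \<subseteq> S" "\<And>k. k \<in> K \<Longrightarrow> norm (j k) = norm k"
    and WjR: "\<And>k. k \<in> K \<Longrightarrow> W (j (R k)) = j k"
  shows "\<exists>\<Phi>. clinear_on UNIV \<Phi> \<and> range \<Phi> \<subseteq> S \<and> (\<forall>x. norm (\<Phi> x) = norm x) \<and>
    (\<forall>k\<in>K. \<Phi> k = j k) \<and> (\<forall>x. W (\<Phi> (R x)) = \<Phi> x)"
proof -
  have subS: "csubspace S" and clS: "closed S"
    using S by (auto simp: closed_csubspace_iff)
  note Rlin = unitary_opD(1)[OF R]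
  define M where "M = {x. \<exists>n. (R ^^ n) x \<in> K}"
  define N where "N x = (LEAST n. (R ^^ n) x \<in> K)" for x
  define g where "g x = (W ^^ N x) (j ((R ^^ N x) x))" for x
  note Rn = unitary_op_funpow[OF R] and Wn = unitary_op_funpow[OF W]
  have NK: "(R ^^ N x) x \<in> K" if "x \<in> M" for x
    using that unfolding M_def N_def by (auto intro: LeastI)
  have up: "(R ^^ (m + n)) x \<in> K" if "(R ^^ n) x \<in> K" for m n x
    using that RK by (induction m) auto
  \<comment> \<open>\<open>W (j (R k)) = j k\<close> makes the value independent of the exponent,
    once that is large enough. Two vectors can then be treated at a common exponent, which gives
    linearity of \<open>g\<close>.\<close>
  have ge: "(W ^^ (m + n)) (j ((R ^^ (m + n)) x)) = (W ^^ n) (j ((R ^^ n) x))"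
    if "(R ^^ n) x \<in> K" for m n x
  proof (induction m)
    case (Suc m)
    have "(W ^^ (Suc m + n)) (j ((R ^^ (Suc m + n)) x))
        = (W ^^ (m + n)) (W (j (R ((R ^^ (m + n)) x))))"
      by (simp add: funpow_swap1)
    also have "\<dots> = (W ^^ (m + n)) (j ((R ^^ (m + n)) x))"
      by (simp add: WjR up[OF that])
    finally show ?case using Suc by simp
  qed simp
  have gN: "g x = (W ^^ (m + N x)) (j ((R ^^ (m + N x)) x))" if "x \<in> M" for m x
    using ge[OF NK[OF that]] by (simp add: g_def)
  have geq: "g x = (W ^^ n) (j ((R ^^ n) x))" if "(R ^^ n) x \<in> K" for n x
  proof -
    have "N x \<le> n" unfolding N_def by (rule Least_le) (rule that)
    then show ?thesis
      using gN[of x "n - N x"] that by (auto simp: M_def)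
  qed
  have common: "\<exists>n. (R ^^ n) x \<in> K \<and> (R ^^ n) y \<in> K" if "x \<in> M" "y \<in> M" for x y
    using up[OF NK[OF that(1)], of "N y"] up[OF NK[OF that(2)], of "N x"]
    by (auto simp: add.commute)
  have M: "csubspace M"
    unfolding csubspace_def
  proof (intro conjI ballI allI)
    show "0 \<in> M"
      using csubspaceD(1)[OF K] by (auto simp: M_def intro: exI[of _ 0])
  next
    fix x y assume "x \<in> M" "y \<in> M"
    then obtain n where "(R ^^ n) x \<in> K" "(R ^^ n) y \<in> K" using common by blast
    then have "(R ^^ n) (x + y) \<in> K"
      by (simp add: clinear_onD[OF unitary_opD(1)[OF Rn]] csubspaceD[OF K])
    then show "x + y \<in> M" by (auto simp: M_def)
  next
    fix c x assume "x \<in> M"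
    then obtain n where "(R ^^ n) x \<in> K" by (auto simp: M_def)
    then have "(R ^^ n) (c *\<^sub>C x) \<in> K"
      by (simp add: clinear_onD[OF unitary_opD(1)[OF Rn]] csubspaceD[OF K])
    then show "c *\<^sub>C x \<in> M" by (auto simp: M_def)
  qed
  have jS: "j k \<in> S" if "k \<in> K" for k using j(2) that by auto
  have g: "clinear_on M g"
    unfolding clinear_on_def
  proof (intro conjI ballI allI)
    fix x y assume "x \<in> M" "y \<in> M"
    then obtain n where n: "(R ^^ n) x \<in> K" "(R ^^ n) y \<in> K" using common by blast
    then have "(R ^^ n) (x + y) \<in> K"
      by (simp add: clinear_onD[OF unitary_opD(1)[OF Rn]] csubspaceD[OF K])
    then show "g (x + y) = g x + g y"
      using n by (simp add: geq clinear_onD[OF unitary_opD(1)[OF Rn]] clinear_onD[OF j(1)]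
          clinear_onD[OF unitary_opD(1)[OF Wn]] jS)
  next
    fix c x assume "x \<in> M"
    then obtain n where n: "(R ^^ n) x \<in> K" by (auto simp: M_def)
    then have "(R ^^ n) (c *\<^sub>C x) \<in> K"
      by (simp add: clinear_onD[OF unitary_opD(1)[OF Rn]] csubspaceD[OF K])
    then show "g (c *\<^sub>C x) = c *\<^sub>C g x"
      using n by (simp add: geq clinear_onD[OF unitary_opD(1)[OF Rn]] clinear_onD[OF j(1)]
          clinear_onD[OF unitary_opD(1)[OF Wn]] jS)
  qed
  have gnorm: "norm x = norm (g x)" if "x \<in> M" for x
    using NK[OF that] by (simp add: g_def unitary_opD(5)[OF Wn] unitary_opD(5)[OF Rn] jS j(3))
  have gS: "g ` M \<subseteq> S"
    using NK by (auto simp: g_def intro!: unitary_opD(2)[OF Wn] jS)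
  \<comment> \<open>The closure of \<open>M\<close> contains \<open>K\<close> and is reducing:
    \<open>R\<close> keeps the exponent of a vector admissible, and the adjoint, being the inverse,
    raises it by one.\<close>
  have dense: "closure M = UNIV"
  proof -
    let ?R' = "hadjoint UNIV R"
    have "reducing R (closure M)"
      unfolding reducing_def
    proof (intro conjI)
      show "closed_csubspace (closure M)" by (rule closed_csubspace_closure[OF M])
      have "R x \<in> M" if "x \<in> M" for x
      proof -
        have "R ((R ^^ N x) x) \<in> K" using NK[OF that] RK by auto
        then have "(R ^^ N x) (R x) \<in> K" by (simp add: funpow_swap1)
        then show ?thesis by (auto simp: M_def)
      qed
      then show "R ` closure M \<subseteq> closure M"
        using closure_subset[of M]
        by (intro image_closure_subset continuous_on_subset[OF unitary_continuous_on[OF R]]) auto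
      have "?R' x \<in> M" if "x \<in> M" for x
      proof -
        have "(R ^^ Suc (N x)) (?R' x) = (R ^^ N x) x"
          by (simp add: funpow_Suc_right unitary_apply_hadjoint[OF R csubspace_UNIV] del: funpow.simps)
        then have "(R ^^ Suc (N x)) (?R' x) \<in> K" using NK[OF that] by simp
        then show ?thesis unfolding M_def by blast
      qed
      then show "?R' ` closure M \<subseteq> closure M"
        using closure_subset[of M]
        by (intro image_closure_subset continuous_on_subset[OF unitary_continuous_on[OF
              unitary_op_hadjoint[OF R csubspace_UNIV]]]) auto
    qed
    moreover have "K \<subseteq> M" by (auto simp: M_def intro: exI[of _ 0])
    then have "K \<subseteq> closure M" using closure_subset by blast
    ultimately show ?thesis
      using cyc unfolding star_cyclic_def by blast
  qed
  obtain \<Phi> where \<Phi>: "unitary_op (closure ((\<lambda>x. x) ` M)) (closure (g ` M)) \<Phi>" "\<forall>x\<in>M. \<Phi> x = g x"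
    using unitary_between_closures[of M "\<lambda>x. x" g] M g gnorm by (auto simp: clinear_on_def)
  then have \<Phi>u: "unitary_op UNIV (closure (g ` M)) \<Phi>"
    by (simp add: dense)
  have sub: "closure (g ` M) \<subseteq> S"
    using gS clS by (rule closure_minimal)
  have \<Phi>S: "range \<Phi> \<subseteq> S"
    using sub \<Phi>u by (auto simp: unitary_op_def)
  have KM: "K \<subseteq> M" by (auto simp: M_def intro: exI[of _ 0])
  have gk: "g k = j k" if "k \<in> K" for k
    using geq[of 0 k] that by simp
  have WM: "W (\<Phi> (R x)) = \<Phi> x" if "x \<in> M" for x
  proof -
    have n: "(R ^^ N x) (R x) \<in> K" "(R ^^ Suc (N x)) x \<in> K"
      using NK[OF that] RK by (auto simp: funpow_swap1)
    then have "R x \<in> M" by (auto simp: M_def)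
    then have "\<Phi> (R x) = (W ^^ N x) (j ((R ^^ Suc (N x)) x))"
      using \<Phi>(2) geq[OF n(1)] by (simp add: funpow_swap1)
    then have "W (\<Phi> (R x)) = (W ^^ Suc (N x)) (j ((R ^^ Suc (N x)) x))"
      by simp
    also have "\<dots> = \<Phi> x"
      using \<Phi>(2) that geq[OF n(2)] by simp
    finally show ?thesis .
  qed
  have cont: "continuous_on UNIV (\<lambda>x. W (\<Phi> (R x)))"
  proof (rule continuous_on_compose2[OF unitary_continuous_on[OF W subS]])
    show "continuous_on UNIV (\<lambda>x. \<Phi> (R x))"
      by (rule continuous_on_compose2[OF unitary_continuous_on[OF \<Phi>u csubspace_UNIV]
            unitary_continuous_on[OF R csubspace_UNIV]]) simp
  qed (use \<Phi>S in auto)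
  have "closed {x. W (\<Phi> (R x)) = \<Phi> x}"
    by (rule closed_Collect_eq[OF cont unitary_continuous_on[OF \<Phi>u csubspace_UNIV]])
  then have "closure M \<subseteq> {x. W (\<Phi> (R x)) = \<Phi> x}"
    using WM by (intro closure_minimal) auto
  then have "\<forall>x. W (\<Phi> (R x)) = \<Phi> x"
    by (auto simp: dense)
  then show ?thesis
    using \<Phi>S unitary_opD(1)[OF \<Phi>u] unitary_opD(5)[OF \<Phi>u] \<Phi>(2) gk KM
    by (intro exI[of _ \<Phi>]) auto
qed


section \<open>Defect operators\<close>

text \<open>The binomial coefficients of \<open>(1 - x)\<close> to the power \<open>1/2\<close>.\<close>

definition sqrt_coeff :: "nat \<Rightarrow> real" where
  "sqrt_coeff n = ((1/2) gchoose n) * (- 1) ^ n"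

text \<open>Up to a factorial the coefficient is \<open>pochhammer (- (1/2)) (Suc n)\<close>, in
  which only the first factor is negative.\<close>

lemma sqrt_coeff_nonpos: "sqrt_coeff (Suc n) \<le> 0"
proof -
  have "sqrt_coeff (Suc n) = pochhammer (- (1/2)) (Suc n) / fact (Suc n)"
    by (simp add: sqrt_coeff_def gbinomial_pochhammer flip: power_mult_distrib)
  also have "pochhammer (- (1/2)) (Suc n) = - (1/2) * pochhammer (1/2 :: real) n"
    by (simp add: pochhammer_rec)
  finally show ?thesis
    by (simp add: pochhammer_nonneg)
qed

text \<open>All coefficients but the first are nonpositive, and the partial sums are nonnegative.\<close>

lemma summable_abs_sqrt_coeff: "summable (\<lambda>n. \<bar>sqrt_coeff n\<bar>)"
proof -
  have "(\<Sum>n<k. \<bar>sqrt_coeff (Suc n)\<bar>) \<le> 1" for k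
  proof -
    \<comment> \<open>Partial summation multiplies the generating function by 1 / (1 - x), so the
      sums are the coefficients of (1 - x) to the power -1/2.\<close>
    have "(\<Sum>n\<le>k. sqrt_coeff n) = (- 1) ^ k * ((- (1/2)) gchoose k)"
      using gbinomial_sum_lower_neg[of "1/2 :: real" k] by (simp add: sqrt_coeff_def)
    also have "\<dots> = pochhammer (1/2) k / fact k"
      by (simp add: gbinomial_pochhammer flip: power_mult_distrib)
    also have "\<dots> \<ge> 0"
      by (simp add: pochhammer_nonneg)
    finally have "0 \<le> sqrt_coeff 0 + (\<Sum>n<k. sqrt_coeff (Suc n))"
      by (simp add: sum.atMost_shift)
    moreover have "(\<Sum>n<k. \<bar>sqrt_coeff (Suc n)\<bar>) = - (\<Sum>n<k. sqrt_coeff (Suc n))"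
      by (simp add: sqrt_coeff_nonpos abs_of_nonpos sum_negf)
    ultimately show ?thesis
      by (simp add: sqrt_coeff_def)
  qed
  then have "summable (\<lambda>n. \<bar>sqrt_coeff (Suc n)\<bar>)"
    by (intro bounded_imp_summable[where B = 1]) (simp_all flip: lessThan_Suc_atMost del: sum.lessThan_Suc)
  then show ?thesis
    by (subst summable_Suc_iff[symmetric])
qed

text \<open>The series squares to 1 - x: Vandermonde with exponents 1/2 + 1/2 = 1.\<close>

lemma sqrt_coeff_convolution:
  "(\<Sum>k\<le>n. sqrt_coeff k * sqrt_coeff (n - k)) = (if n = 0 then 1 else if n = 1 then - 1 else 0)"
proof -
  have "(\<Sum>k\<le>n. sqrt_coeff k * sqrt_coeff (n - k))
      = (\<Sum>k\<le>n. ((1/2) gchoose k) * ((1/2) gchoose (n - k)) * (- 1) ^ n)"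
    by (rule sum.cong) (auto simp: sqrt_coeff_def mult_ac simp flip: power_add)
  also have "\<dots> = ((1/2 + 1/2) gchoose n) * (- 1 :: real) ^ n"
    using gbinomial_Vandermonde[of "1/2 :: real" "1/2" n]
    by (simp add: atMost_atLeast0 flip: sum_distrib_right)
  also have "((1/2 + 1/2) gchoose n) = real (1 choose n)"
    using binomial_gbinomial[of 1 n, where 'a = real] by simp
  finally show ?thesis
    by (cases n) (auto simp: binomial_eq_0)
qed

text \<open>Meant for the moments \<open>c n\<close> = <T^n x, y> of a contraction T. Absolute
  summability permits grouping along \<open>n + m = N\<close>, where the inner sums are the
  coefficients of 1 - x, so only \<open>N = 0\<close> and \<open>N = 1\<close> survive.\<close>

lemma
  fixes c :: "nat \<Rightarrow> complex"
  assumes c: "\<And>n. cmod (c n) \<le> C"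
  shows summable_sqrt_coeff_double:
      "(\<lambda>(n, m). of_real (sqrt_coeff n * sqrt_coeff m) * c (n + m)) summable_on UNIV \<times> UNIV"
    and infsum_sqrt_coeff_double:
      "(\<Sum>\<^sub>\<infinity>(n, m)\<in>UNIV\<times>UNIV. of_real (sqrt_coeff n * sqrt_coeff m) * c (n + m)) = c 0 - c 1"
proof -
  let ?a = sqrt_coeff
  have abs: "(\<lambda>n. \<bar>?a n\<bar>) summable_on UNIV"
    using summable_abs_sqrt_coeff by (intro norm_summable_imp_summable_on) simp
  have C: "0 \<le> C"
    using c[of 0] norm_ge_zero order.trans by blast
  let ?g = "\<lambda>(n, m). \<bar>?a n\<bar> * (C * \<bar>?a m\<bar>)"
  have "(\<lambda>p. norm (?g p)) summable_on UNIV \<times> UNIV"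
  proof (subst Infinite_Sum.abs_summable_on_Sigma_iff, intro conjI ballI)
    fix n
    show "(\<lambda>m. norm (?g (n, m))) summable_on UNIV"
      using abs by (auto simp: abs_mult intro!: summable_on_cmult_right)
  next
    have "(\<lambda>n. \<bar>?a n\<bar> * (C * (\<Sum>\<^sub>\<infinity>m. \<bar>?a m\<bar>))) summable_on UNIV"
      using abs by (auto intro!: summable_on_cmult_left)
    then show "(\<lambda>n. norm (\<Sum>\<^sub>\<infinity>m. norm (?g (n, m)))) summable_on UNIV"
      using C by (simp add: abs_mult infsum_cmult_right' infsum_nonneg)
  qed
  then have "(\<lambda>p. norm (case p of (n, m) \<Rightarrow> of_real (?a n * ?a m) * c (n + m))) summable_on UNIV \<times> UNIV"
  proof (rule Infinite_Sum.abs_summable_on_comparison_test)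
    fix p :: "nat \<times> nat"
    obtain n m where p: "p = (n, m)" by force
    show "norm (case p of (n, m) \<Rightarrow> of_real (?a n * ?a m) * c (n + m)) \<le> norm (?g p)"
      using C mult_left_mono[OF c[of "n + m"], of "\<bar>?a n\<bar> * \<bar>?a m\<bar>"]
      by (simp add: p norm_mult abs_mult mult_ac)
  qed
  then show sm: "(\<lambda>(n, m). of_real (?a n * ?a m) * c (n + m)) summable_on UNIV \<times> UNIV"
    by (rule Infinite_Sum.abs_summable_summable)
  let ?F = "\<lambda>(N, k). of_real (?a k * ?a (N - k)) * c N"
  let ?S = "Sigma UNIV (\<lambda>N. {..N})"
  have sm': "?F summable_on ?S"
    using sm by (subst summable_on_reindex_bij_witness[where T = "UNIV \<times> UNIV"
          and i = "\<lambda>(n, m). (n + m, n)" and j = "\<lambda>(N, k). (k, N - k)"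
          and h = "\<lambda>(n, m). of_real (?a n * ?a m) * c (n + m)"]) auto
  have "(\<Sum>\<^sub>\<infinity>(n, m)\<in>UNIV\<times>UNIV. of_real (?a n * ?a m) * c (n + m)) = infsum ?F ?S"
    by (rule infsum_reindex_bij_witness[where i = "\<lambda>(N, k). (k, N - k)" and j = "\<lambda>(n, m). (n + m, n)"]) auto
  also have "\<dots> = (\<Sum>\<^sub>\<infinity>N. \<Sum>\<^sub>\<infinity>k\<in>{..N}. of_real (?a k * ?a (N - k)) * c N)"
    using infsum_Sigma'_banach[OF sm'] by simp
  also have "\<dots> = (\<Sum>\<^sub>\<infinity>N. of_real (\<Sum>k\<le>N. ?a k * ?a (N - k)) * c N)"
    by (simp add: sum_distrib_right)
  also have "\<dots> = (\<Sum>\<^sub>\<infinity>N\<in>{0, 1}. of_real (\<Sum>k\<le>N. ?a k * ?a (N - k)) * c N)"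
    by (rule infsum_cong_neutral) (auto simp: sqrt_coeff_convolution)
  also have "\<dots> = c 0 - c 1"
    by (simp only: sqrt_coeff_convolution) simp
  finally show "(\<Sum>\<^sub>\<infinity>(n, m)\<in>UNIV\<times>UNIV. of_real (?a n * ?a m) * c (n + m)) = c 0 - c 1" .
qed

text \<open>\<open>D = (I - Y\<^sup>*Y)\<close> to the power \<open>1/2\<close>, as a binomial series.\<close>

lemma defect_operator_ex:
  fixes Y :: "'a::chilbert_space \<Rightarrow> 'b::chilbert_space"
  assumes Y: "contraction_op UNIV UNIV Y"
  shows "\<exists>D :: 'a \<Rightarrow> 'a. clinear_on UNIV D \<and>
    (\<forall>x y. cinner (D x) (D y) = cinner x y - cinner (Y x) (Y y))"
proof -
  let ?a = sqrt_coeff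
  have Ylin: "clinear_on UNIV Y" and Yn: "\<And>x. norm (Y x) \<le> norm x"
    using Y by (auto simp: contraction_op_def)
  \<comment> \<open>\<open>T\<close> is self-adjoint and contractive, so the pairing of
    \<open>(T ^^ n) x\<close> with \<open>(T ^^ m) y\<close> is bounded and depends on the exponents
    only through \<open>n + m\<close>.\<close>
  define T where "T x = hadjoint UNIV Y (Y x)" for x
  have cl: "closed_csubspace (UNIV :: 'a set)"
    by (simp add: closed_csubspace_iff)
  have Tr: "cinner z (T x) = cinner (Y z) (Y x)" for x z
    unfolding T_def by (rule cinner_hadjoint[OF cl Ylin, of 1]) (simp_all add: Yn)
  have Tl: "cinner (T x) z = cinner (Y x) (Y z)" for x z
    using Tr[of z x] by (metis cinner_commute)
  have Tlin: "clinear_on UNIV T"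
    unfolding clinear_on_def
    by (intro conjI ballI allI; rule cinner_eqI)
      (simp_all add: Tr cinner_add_right cinner_scaleC_right clinear_onD[OF Ylin])
  have Tn: "norm (T x) \<le> norm x" for x
  proof -
    have "(norm (T x))\<^sup>2 = cmod (cinner (T x) (T x))"
      by (rule cmod_cinner_self[symmetric])
    also have "\<dots> = cmod (cinner (Y (T x)) (Y x))"
      by (simp only: Tr)
    also have "\<dots> \<le> norm (Y (T x)) * norm (Y x)"
      by (rule norm_cinner_le)
    also have "\<dots> \<le> norm (T x) * norm x"
      by (intro mult_mono Yn) auto
    finally show ?thesis
      by (cases "T x = 0") (simp_all add: power2_eq_square)
  qed
  have Tp_lin: "clinear_on UNIV (T ^^ n)" for n
    by (induction n) (use Tlin in \<open>auto simp: clinear_on_def\<close>)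
  have Tpn: "norm ((T ^^ n) x) \<le> norm x" for n x
    by (induction n) (auto intro: order.trans[OF Tn])
  have Tpow: "cinner ((T ^^ n) x) ((T ^^ m) y) = cinner ((T ^^ (n + m)) x) y" for n m x y
  proof (induction m arbitrary: n)
    case (Suc m)
    have "cinner ((T ^^ n) x) ((T ^^ Suc m) y) = cinner (T ((T ^^ n) x)) ((T ^^ m) y)"
      by (simp add: Tr Tl)
    also have "\<dots> = cinner ((T ^^ Suc n) x) ((T ^^ m) y)"
      by simp
    also have "\<dots> = cinner ((T ^^ (n + Suc m)) x) y"
      by (simp only: Suc add_Suc add_Suc_right)
    finally show ?case .
  qed simp
  define D where "D x = (\<Sum>\<^sub>\<infinity>n. ?a n *\<^sub>R (T ^^ n) x)" for x
  \<comment> \<open>A contraction may have norm one, the boundary of the disc of convergence;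
    absolutely summable coefficients still suffice.\<close>
  have sm: "(\<lambda>n. ?a n *\<^sub>R (T ^^ n) x) summable_on UNIV" for x
  proof (rule norm_summable_imp_summable_on)
    have "summable (\<lambda>n. \<bar>?a n\<bar> * norm x)"
      by (intro summable_mult2 summable_abs_sqrt_coeff)
    then show "summable (\<lambda>n. norm (?a n *\<^sub>R (T ^^ n) x))"
      by (rule summable_comparison_test_ev[rotated])
        (auto intro!: always_eventually mult_left_mono Tpn)
  qed
  have "clinear_on UNIV D"
    unfolding clinear_on_def
  proof (intro conjI ballI allI)
    fix x y
    show "D (x + y) = D x + D y"
      unfolding D_def
      by (subst infsum_add[OF sm sm, symmetric]) (simp add: clinear_onD[OF Tp_lin] scaleR_add_right)
  next
    fix c x
    have "D (c *\<^sub>C x) = (\<Sum>\<^sub>\<infinity>n. c *\<^sub>C (?a n *\<^sub>R (T ^^ n) x))"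
      by (simp add: D_def clinear_onD[OF Tp_lin] scaleR_scaleC)
    also have "\<dots> = c *\<^sub>C D x"
      unfolding D_def
      by (rule infsumI[OF has_sum_bounded_linear[OF bounded_linear_scaleC has_sum_infsum[OF sm]]])
    finally show "D (c *\<^sub>C x) = c *\<^sub>C D x" .
  qed
  moreover have "cinner (D x) (D y) = cinner x y - cinner (Y x) (Y y)" for x y
  proof -
    let ?c = "\<lambda>n. cinner ((T ^^ n) x) y"
    have bd: "cmod (?c n) \<le> norm x * norm y" for n
      using norm_cinner_le[of "(T ^^ n) x" y] Tpn[of n x]
      by (meson mult_right_mono norm_ge_zero order.trans)
    have "cinner ((T ^^ n) x) (D y) = (\<Sum>\<^sub>\<infinity>m. ?a m *\<^sub>R ?c (n + m))" for n
      unfolding D_def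
      using infsumI[OF has_sum_bounded_linear[OF
          bounded_bilinear.bounded_linear_right[OF bounded_bilinear_cinner] has_sum_infsum[OF sm]],
          of "(T ^^ n) x" y]
      by (simp add: cinner_scaleR_right Tpow)
    moreover have "cinner (D x) (D y) = (\<Sum>\<^sub>\<infinity>n. ?a n *\<^sub>R cinner ((T ^^ n) x) (D y))"
      unfolding D_def[of x]
      using infsumI[OF has_sum_bounded_linear[OF
          bounded_bilinear.bounded_linear_left[OF bounded_bilinear_cinner] has_sum_infsum[OF sm]],
          of x "D y"]
      by (simp add: cinner_scaleR_left)
    ultimately have "cinner (D x) (D y) = (\<Sum>\<^sub>\<infinity>n. \<Sum>\<^sub>\<infinity>m. of_real (?a n * ?a m) * ?c (n + m))"
      by (simp add: scaleR_conv_of_real mult.assoc infsum_cmult_right')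
    also have "\<dots> = (\<Sum>\<^sub>\<infinity>(n, m)\<in>UNIV\<times>UNIV. of_real (?a n * ?a m) * ?c (n + m))"
      by (rule infsum_Sigma'_banach[OF summable_sqrt_coeff_double[OF bd]])
    also have "\<dots> = ?c 0 - ?c 1"
      by (rule infsum_sqrt_coeff_double[OF bd])
    finally show ?thesis
      by (simp add: Tl)
  qed
  ultimately show ?thesis by blast
qed


section \<open>Feedback connection of colligations\<close>

text \<open>The output \<open>C0 h\<close> of the first colligation drives the second, whose output
  returns through \<open>B0\<close>. As the first has no feedthrough term, both signals are explicit
  in the state \<open>(h, g)\<close>.\<close>

definition closed_loop ::
  "('h \<Rightarrow> 'h) \<Rightarrow> ('s::chilbert_space \<Rightarrow> 'h) \<Rightarrow> ('h \<Rightarrow> 'd) \<Rightarrow>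
   ('g \<Rightarrow> 'g) \<Rightarrow> ('d \<Rightarrow> 'g) \<Rightarrow> ('g \<Rightarrow> 's) \<Rightarrow> ('d \<Rightarrow> 's) \<Rightarrow>
   'h::chilbert_space \<times> 'g::chilbert_space \<Rightarrow> 'h \<times> 'g" where
  "closed_loop A0 B0 C0 A1 B1 C1 D1 =
     (\<lambda>(h, g). (A0 h + B0 (C1 g + D1 (C0 h)), A1 g + B1 (C0 h)))"

lemma bounded_opD:
  assumes "bounded_op S T f"
  shows "clinear_on S f" "x \<in> S \<Longrightarrow> f x \<in> T"
  using assms by (auto simp: bounded_op_def)

lemma funpow_mem: "f ` S \<subseteq> S \<Longrightarrow> x \<in> S \<Longrightarrow> (f ^^ n) x \<in> S"
  by (induction n) auto

lemma clinear_on_funpow: "clinear_on S f \<Longrightarrow> f ` S \<subseteq> S \<Longrightarrow> clinear_on S (f ^^ n)"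
  by (induction n) (auto simp: clinear_on_def funpow_mem)

lemma variation_of_constants:
  assumes A: "clinear_on S A" "A ` S \<subseteq> S" and S: "csubspace S"
    and h: "h 0 \<in> S" "\<And>n. b n \<in> S" "\<And>n. h (Suc n) = A (h n) + b n"
  shows "h n = (A ^^ n) (h 0) + (\<Sum>k<n. (A ^^ (n - 1 - k)) (b k))"
proof (induction n)
  case (Suc n)
  note mem = funpow_mem[OF A(2)]
  have "A (h n) = A ((A ^^ n) (h 0)) + (\<Sum>k<n. A ((A ^^ (n - 1 - k)) (b k)))"
    by (subst Suc) (simp add: clinear_onD[OF A(1)] clinear_on_sum[OF A(1) S] mem h csubspace_sum[OF S])
  also have "(\<Sum>k<n. A ((A ^^ (n - 1 - k)) (b k))) = (\<Sum>k<n. (A ^^ (Suc n - 1 - k)) (b k))"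
  proof (rule sum.cong)
    fix k assume "k \<in> {..<n}"
    then have "Suc n - 1 - k = Suc (n - 1 - k)" by auto
    then show "A ((A ^^ (n - 1 - k)) (b k)) = (A ^^ (Suc n - 1 - k)) (b k)" by simp
  qed simp
  finally show ?case
    by (simp add: h(3))
qed simp

lemma S_plus_cong: "(\<And>k. k < n \<Longrightarrow> d k = d' k) \<Longrightarrow> S_plus A B C d n = S_plus A B C d' n"
  by (auto simp: S_plus_def intro!: sum.cong)

lemma io_map_cong: "(\<And>k. k \<le> n \<Longrightarrow> e k = e' k) \<Longrightarrow> io_map A B C D e n = io_map A B C D e' n"
  by (auto simp: io_map_def intro!: sum.cong)

lemma io_map_add:
  assumes A: "bounded_op H H A" and B: "bounded_op E H B" and C: "bounded_op H F C" and D: "bounded_op E F D"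
    and "\<And>k. e k \<in> E" "\<And>k. e' k \<in> E"
  shows "io_map A B C D (\<lambda>k. e k + e' k) n = io_map A B C D e n + io_map A B C D e' n"
proof -
  have "bounded_op H H A \<Longrightarrow> A ` H \<subseteq> H" by (auto simp: bounded_op_def)
  note An = clinear_on_funpow[OF bounded_opD(1)[OF A] this[OF A]] funpow_mem[OF this[OF A]]
  show ?thesis
    by (simp add: io_map_def assms(5,6) clinear_onD[OF bounded_opD(1)[OF D]]
        clinear_onD[OF bounded_opD(1)[OF B]] clinear_onD[OF bounded_opD(1)[OF C]]
        clinear_onD[OF An(1)] An(2) bounded_opD(2)[OF B] sum.distrib)
qed

text \<open>The operator \<open>\<Omega>\<^sup>+S\<^sup>+\<close> is strictly causal, so \<open>I - \<Omega>\<^sup>+S\<^sup>+\<close> is injective.\<close>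

lemma feedback_inv_eqI:
  assumes d: "\<And>n. d n \<in> F"
    and y: "\<And>n. y n = d n - io_map A1 B1 C1 D1 (S_plus A0 B0 C0 d) n"
  shows "feedback_inv F (\<lambda>d. io_map A1 B1 C1 D1 (S_plus A0 B0 C0 d)) y = d"
proof -
  let ?T = "\<lambda>d. io_map A1 B1 C1 D1 (S_plus A0 B0 C0 d)"
  let ?f = "\<lambda>d n. d n - ?T d n"
  have "inj_on ?f {d. \<forall>n. d n \<in> F}"
  proof (rule inj_onI)
    fix d d' assume eq: "?f d = ?f d'"
    have "d n = d' n" for n
    proof (induction n rule: less_induct)
      case (less n)
      \<comment> \<open>\<open>io_map\<close> at time \<open>n\<close> reads times up to
        \<open>n\<close>, and \<open>S_plus\<close> at each of these reads strictly earlier ones, so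
        the induction hypothesis covers all that matters.\<close>
      then have "?T d n = ?T d' n"
        by (intro io_map_cong S_plus_cong) auto
      with fun_cong[OF eq, of n] show ?case by simp
    qed
    then show "d = d'" by blast
  qed
  then have "inv_into {d. \<forall>n. d n \<in> F} ?f (?f d) = d"
    by (rule inv_into_f_f) (use d in blast)
  moreover have "y = ?f d" using y by blast
  ultimately show ?thesis
    unfolding feedback_inv_def by simp
qed

text \<open>With \<open>e\<close> and \<open>d\<close> the two signals along the orbit, the loop
  equations read \<open>h\<close> = S0 x + S2 d, \<open>e\<close> = S1 x + S d and \<open>d\<close>
  = Omega e. Eliminating \<open>e\<close> leaves (I - Omega S) d = Omega S1 x.\<close>

lemma closed_loop_trajectory:
  assumes sub: "csubspace H0" "csubspace H1"
    and A0: "bounded_op H0 H0 A0" and B0: "bounded_op F H0 B0" and C0: "bounded_op H0 E C0"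
    and A1: "bounded_op H1 H1 A1" and B1: "bounded_op E H1 B1" and C1: "bounded_op H1 F C1"
    and D1: "bounded_op E F D1" and F: "csubspace F" and x: "x \<in> H0"
  shows "fst ((closed_loop A0 B0 C0 A1 B1 C1 D1 ^^ n) (x, 0)) =
    S0_plus A0 x n + S2_plus A0 B0 (feedback_inv F (\<lambda>d. io_map A1 B1 C1 D1 (S_plus A0 B0 C0 d))
      (io_map A1 B1 C1 D1 (S1_plus A0 C0 x))) n"
proof -
  define t where "t n = (closed_loop A0 B0 C0 A1 B1 C1 D1 ^^ n) (x, 0)" for n
  define h where "h n = fst (t n)" for n
  define g where "g n = snd (t n)" for n
  define e where "e n = C0 (h n)" for n
  define d where "d n = C1 (g n) + D1 (e n)" for n
  note subD = csubspaceD[OF sub(1)] csubspaceD[OF sub(2)] csubspaceD[OF F]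
  have h0: "h 0 = x" "g 0 = 0" by (auto simp: h_def g_def t_def)
  have hS: "h (Suc n) = A0 (h n) + B0 (d n)" and gS: "g (Suc n) = A1 (g n) + B1 (e n)" for n
    by (auto simp: h_def g_def t_def d_def e_def closed_loop_def split: prod.splits)
  have mem: "h n \<in> H0 \<and> g n \<in> H1" for n
  proof (induction n)
    case (Suc n)
    then show ?case
      by (auto simp: hS gS d_def e_def intro!: subD bounded_opD(2)[OF A0] bounded_opD(2)[OF B0]
          bounded_opD(2)[OF C0] bounded_opD(2)[OF A1] bounded_opD(2)[OF B1]
          bounded_opD(2)[OF C1] bounded_opD(2)[OF D1])
  qed (use x subD in \<open>auto simp: h0\<close>)
  have eE: "e n \<in> E" for n
    using mem bounded_opD(2)[OF C0] by (auto simp: e_def)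
  have dF: "d n \<in> F" for n
    using mem eE by (auto simp: d_def intro!: subD bounded_opD(2)[OF C1] bounded_opD(2)[OF D1])
  have img: "A0 ` H0 \<subseteq> H0" "A1 ` H1 \<subseteq> H1"
    using A0 A1 by (auto simp: bounded_op_def)
  have h: "h n = S0_plus A0 x n + S2_plus A0 B0 d n" for n
    unfolding S0_plus_def S2_plus_def h0(1)[symmetric]
    by (rule variation_of_constants[OF bounded_opD(1)[OF A0] img(1) sub(1)])
      (simp_all add: mem hS bounded_opD(2)[OF B0] dF)
  \<comment> \<open>The second state starts at 0, so it is a response to \<open>e\<close> alone;
    this is what makes \<open>d\<close> the \<open>io_map\<close> of \<open>e\<close>, with no free
    term.\<close>
  have g: "g n = (\<Sum>k<n. (A1 ^^ (n - 1 - k)) (B1 (e k)))" for n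
  proof -
    have "(A1 ^^ n) 0 = 0"
      by (rule clinear_on_zero[OF clinear_on_funpow[OF bounded_opD(1)[OF A1] img(2)] sub(2)])
    then show ?thesis
      using variation_of_constants[OF bounded_opD(1)[OF A1] img(2) sub(2), of g "\<lambda>k. B1 (e k)" n]
      by (simp add: mem gS bounded_opD(2)[OF B1] eE h0 csubspaceD(1)[OF sub(2)])
  qed
  have memA: "(A0 ^^ k) (B0 (d m)) \<in> H0" "(A1 ^^ k) (B1 (e m)) \<in> H1" for k m
    by (auto intro!: funpow_mem img bounded_opD(2)[OF B0] bounded_opD(2)[OF B1] dF eE)
  have SE: "S_plus A0 B0 C0 d n = C0 (S2_plus A0 B0 d n)" for n
    unfolding S_plus_def S2_plus_def
    by (rule clinear_on_sum[OF bounded_opD(1)[OF C0] sub(1), symmetric]) (rule memA)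
  have S2: "S2_plus A0 B0 d n \<in> H0" for n
    unfolding S2_plus_def by (intro csubspace_sum sub memA)
  have S0: "S0_plus A0 x n \<in> H0" for n
    unfolding S0_plus_def by (intro funpow_mem img x)
  have e: "e = (\<lambda>n. S1_plus A0 C0 x n + S_plus A0 B0 C0 d n)"
  proof
    fix n
    have "C0 (h n) = C0 (S0_plus A0 x n) + C0 (S2_plus A0 B0 d n)"
      unfolding h by (rule clinear_onD(1)[OF bounded_opD(1)[OF C0] S0 S2])
    then show "e n = S1_plus A0 C0 x n + S_plus A0 B0 C0 d n"
      by (simp only: e_def SE S1_plus_def S0_plus_def)
  qed
  have d: "d n = io_map A1 B1 C1 D1 e n" for n
    by (subst d_def)
      (simp add: g clinear_on_sum[OF bounded_opD(1)[OF C1] sub(2)] memA io_map_def)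
  have "d n = io_map A1 B1 C1 D1 (S1_plus A0 C0 x) n + io_map A1 B1 C1 D1 (S_plus A0 B0 C0 d) n" for n
    unfolding d[of n]
    by (subst e, rule io_map_add[OF A1 B1 C1 D1])
      (use S0 S2 SE bounded_opD(2)[OF C0] in \<open>auto simp: S1_plus_def S0_plus_def\<close>)
  then have "feedback_inv F (\<lambda>d. io_map A1 B1 C1 D1 (S_plus A0 B0 C0 d))
      (io_map A1 B1 C1 D1 (S1_plus A0 C0 x)) = d"
    by (intro feedback_inv_eqI dF) (simp add: eq_diff_eq)
  then show ?thesis
    using h[of n] by (simp add: h_def t_def)
qed

lemma unitary_colligation_of_unitary:
  assumes H: "closed_csubspace H" and E: "csubspace E" and F: "csubspace F"
    and G: "unitary_op (H \<times> E) (H \<times> F) G"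
  shows "unitary_colligation H E F (\<lambda>h. fst (G (h, 0))) (\<lambda>e. fst (G (0, e)))
    (\<lambda>h. snd (G (h, 0))) (\<lambda>e. snd (G (0, e)))"
proof -
  have subH: "csubspace H" using H by (simp add: closed_csubspace_iff)
  note z = csubspaceD(1)[OF subH] csubspaceD(1)[OF E]
  note D = unitary_opD[OF G]
  have add: "G (h + h', e + e') = G (h, e) + G (h', e')"
    if "h \<in> H" "h' \<in> H" "e \<in> E" "e' \<in> E" for h h' e e'
    using clinear_onD(1)[OF D(1), of "(h, e)" "(h', e')"] that by simp
  have scale: "G (c *\<^sub>C h, c *\<^sub>C e) = c *\<^sub>C G (h, e)" if "h \<in> H" "e \<in> E" for h e c
    using clinear_onD(2)[OF D(1), of "(h, e)" c] that by (simp add: scaleC_prod_def)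
  have mem: "fst (G (h, e)) \<in> H" "snd (G (h, e)) \<in> F" if "h \<in> H" "e \<in> E" for h e
    using D(2)[of "(h, e)"] that by (auto simp: mem_Times_iff)
  have nrm: "norm (fst (G (h, e))) \<le> norm (h, e)" "norm (snd (G (h, e))) \<le> norm (h, e)"
    if "h \<in> H" "e \<in> E" for h e
    using D(5)[of "(h, e)"] that norm_fst_le[of "fst (G (h, e))" "snd (G (h, e))"]
      norm_snd_le[of "snd (G (h, e))" "fst (G (h, e))"] by auto
  have bdH: "bounded_op H H (\<lambda>h. fst (G (h, 0)))" "bounded_op H F (\<lambda>h. snd (G (h, 0)))"
    unfolding bounded_op_def clinear_on_def
    using add[of _ _ 0 0] scale[of _ 0] mem nrm[of _ 0] z
    by (auto simp: norm_Pair scaleC_prod_def intro!: exI[of _ 1])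
  have bdE: "bounded_op E H (\<lambda>e. fst (G (0, e)))" "bounded_op E F (\<lambda>e. snd (G (0, e)))"
    unfolding bounded_op_def clinear_on_def
    using add[of 0 0] scale[of 0] mem nrm[of 0] z
    by (auto simp: norm_Pair scaleC_prod_def intro!: exI[of _ 1])
  have eq: "(fst (G (h, 0)) + fst (G (0, e)), snd (G (h, 0)) + snd (G (0, e))) = G (h, e)"
    if "h \<in> H" "e \<in> E" for h e
    using add[of h 0 0 e] that z by (simp add: prod_eq_iff)
  have "unitary_op (H \<times> E) (H \<times> F)
      (\<lambda>(h, e). (fst (G (h, 0)) + fst (G (0, e)), snd (G (h, 0)) + snd (G (0, e))))"
  proof -
    let ?f = "\<lambda>(h, e). (fst (G (h, 0)) + fst (G (0, e)), snd (G (h, 0)) + snd (G (0, e)))"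
    have fG: "?f p = G p" if "p \<in> H \<times> E" for p
      using eq that by (cases p) auto
    have "?f ` (H \<times> E) = G ` (H \<times> E)"
      by (rule image_cong[OF refl fG])
    then have "?f ` (H \<times> E) = H \<times> F"
      using G by (simp only: unitary_op_def)
    moreover have "clinear_on (H \<times> E) ?f"
      using D(1) csubspaceD[OF csubspace_Times[OF subH E]]
      unfolding clinear_on_def by (simp only: fG cong: ball_cong) simp
    ultimately show ?thesis
      unfolding unitary_op_def using D(4) by (simp only: fG cong: ball_cong) simp
  qed
  with H bdH bdE show ?thesis
    by (simp add: unitary_colligation_def)
qed

lemma unitary_op_ominus:
  assumes U: "unitary_op S T U" and N: "N \<subseteq> S"
  shows "unitary_op (ominus S N) (ominus T (U ` N)) U"
proof -
  note D = unitary_opD[OF U]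
  have "U ` ominus S N = ominus T (U ` N)"
  proof
    show "U ` ominus S N \<subseteq> ominus T (U ` N)"
      using D(2,4) N by (auto simp: ominus_def subset_iff)
    show "ominus T (U ` N) \<subseteq> U ` ominus S N"
    proof
      fix y assume y: "y \<in> ominus T (U ` N)"
      then obtain x where x: "x \<in> S" "U x = y"
        using D(3) by (auto simp: ominus_def)
      have "cinner x t = 0" if "t \<in> N" for t
        using y that N D(4)[OF x(1), of t] x by (auto simp: ominus_def)
      with x show "y \<in> U ` ominus S N"
        by (auto simp: ominus_def)
    qed
  qed
  moreover have "clinear_on (ominus S N) U"
    by (rule clinear_on_subset[OF D(1)]) (auto simp: ominus_def)
  ultimately show ?thesis
    using D(4) by (auto simp: unitary_op_def ominus_def)
qed

text \<open>The complement of \<open>\<iota>\<close> applied to \<open>C\<close> splits into the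
  complement of \<open>L\<close> and the copy of \<open>ominus H0 C\<close>, which \<open>E\<close>
  labels. Used with \<open>D\<close> for the inputs and with \<open>Ds\<close> for the outputs of
  the colligation to be found.\<close>

lemma unitary_op_orthogonal_sum:
  fixes K :: "'k::chilbert_space set" and H0 :: "'h::chilbert_space set"
  assumes K: "closed_csubspace K" and H0: "closed_csubspace H0"
    and \<iota>: "unitary_op H0 L \<iota>" and LK: "L \<subseteq> K"
    and C: "C \<subseteq> H0" and i: "unitary_op E (ominus H0 C) i"
  shows "unitary_op (ominus K L \<times> E) (ominus K (\<iota> ` C)) (\<lambda>(h, e). h + \<iota> (i e))"
proof -
  note \<iota>D = unitary_opD[OF \<iota>] and iD = unitary_opD[OF i]
  have L: "closed_csubspace L"
    by (rule closed_unitary_image[OF H0 \<iota>])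
  have subK: "csubspace K" using K by (simp add: closed_csubspace_iff)
  have iH: "i e \<in> H0" if "e \<in> E" for e
    using iD(2)[OF that] by (simp add: ominus_def)
  have orth: "cinner h (\<iota> y) = 0" "cinner (\<iota> y) h = 0" if "h \<in> ominus K L" "y \<in> H0" for h y
  proof -
    show *: "cinner h (\<iota> y) = 0"
      using that \<iota>D(2) by (auto simp: ominus_def)
    show "cinner (\<iota> y) h = 0"
      using * cinner_commute[of "\<iota> y" h] by simp
  qed
  let ?f = "\<lambda>(h, e). h + \<iota> (i e)"
  have "clinear_on (ominus K L \<times> E) ?f"
    unfolding clinear_on_def
    by (auto simp: clinear_onD[OF iD(1)] clinear_onD[OF \<iota>D(1)] iH scaleC_prod_def scaleC_add_right)
  moreover have "cinner (?f p) (?f q) = cinner p q"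
    if "p \<in> ominus K L \<times> E" "q \<in> ominus K L \<times> E" for p q
    using that by (auto simp: cinner_add_left cinner_add_right orth iH \<iota>D(4) iD(4) cinner_prod_def)
  moreover have "?f ` (ominus K L \<times> E) = ominus K (\<iota> ` C)"
  proof
    have "h + \<iota> (i e) \<in> ominus K (\<iota> ` C)" if h: "h \<in> ominus K L" and e: "e \<in> E" for h e
    proof -
      have "h + \<iota> (i e) \<in> K"
        using h \<iota>D(2)[OF iH[OF e]] LK by (auto simp: ominus_def intro!: csubspaceD[OF subK])
      moreover have "cinner (h + \<iota> (i e)) (\<iota> c) = 0" if "c \<in> C" for c
      proof -
        have "cinner (i e) c = 0"
          using iD(2)[OF e] that by (simp add: ominus_def)
        then show ?thesis
          using orth[OF h, of c] that C \<iota>D(4)[OF iH[OF e], of c]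
          by (auto simp: cinner_add_left)
      qed
      ultimately show ?thesis by (auto simp: ominus_def)
    qed
    then show "?f ` (ominus K L \<times> E) \<subseteq> ominus K (\<iota> ` C)" by auto
    show "ominus K (\<iota> ` C) \<subseteq> ?f ` (ominus K L \<times> E)"
    proof
      \<comment> \<open>The \<open>L\<close>-part of \<open>y\<close>, pulled back to
        \<open>H0\<close>, is still orthogonal to \<open>C\<close> and so carries a label
        \<open>e\<close>; the rest of \<open>y\<close> is the first coordinate.\<close>
      fix y assume y: "y \<in> ominus K (\<iota> ` C)"
      obtain p where p: "p \<in> H0" "\<iota> p = proj L y"
        using \<iota>D(3)[OF proj_mem[OF L]] by blast
      have "cinner p c = 0" if c: "c \<in> C" for c
      proof -
        have cH: "c \<in> H0" using c C by auto
        have "cinner p c = cinner (proj L y) (\<iota> c)"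
          using \<iota>D(4)[OF p(1) cH] by (simp add: p(2))
        also have "\<dots> = cinner y (\<iota> c)"
          by (rule cinner_proj[OF L \<iota>D(2)[OF cH]])
        also have "\<dots> = 0" using y c by (auto simp: ominus_def)
        finally show ?thesis .
      qed
      then have "p \<in> ominus H0 C"
        using p by (auto simp: ominus_def)
      then obtain e where e: "e \<in> E" "i e = p"
        using iD(3) by blast
      have "y - proj L y \<in> ominus K L"
        using y by (intro diff_proj_mem_ominus L K LK) (auto simp: ominus_def)
      moreover have "y = ?f (y - proj L y, e)"
        by (simp add: e p)
      ultimately show "y \<in> ?f ` (ominus K L \<times> E)"
        using e by (intro image_eqI[of _ _ "(y - proj L y, e)"]) auto
    qed
  qed
  ultimately show ?thesis
    unfolding unitary_op_def by blast
qed

text \<open>Isolates what the coupling arguments use: a unitary between two subspaces of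
  \<open>H0\<close> and labels for their complements. Here \<open>j\<close> plays the role of
  \<open>B0\<close>.\<close>

locale isometric_colligation =
  fixes H0 D Ds :: "'h::chilbert_space set" and V :: "'h \<Rightarrow> 'h"
    and E :: "'d::chilbert_space set" and i :: "'d \<Rightarrow> 'h"
    and F :: "'s::chilbert_space set" and j :: "'s \<Rightarrow> 'h"
    and A0 :: "'h \<Rightarrow> 'h" and C0 :: "'h \<Rightarrow> 'd"
  assumes H0: "closed_csubspace H0"
    and D: "closed_csubspace D" "D \<subseteq> H0" and Ds: "closed_csubspace Ds" "Ds \<subseteq> H0"
    and V: "unitary_op D Ds V"
    and E: "closed_csubspace E" and i: "unitary_op E (ominus H0 D) i"
    and F: "closed_csubspace F" and j: "unitary_op F (ominus H0 Ds) j"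
    and A0: "\<And>h. A0 h = V (proj D h)" and C0: "C0 = univ_C (ominus H0 D) E i"
begin

lemma csub: "csubspace H0" "csubspace D" "csubspace Ds" "csubspace E" "csubspace F"
  using H0 D Ds E F by (auto simp: closed_csubspace_iff)

lemma proj_ominus: "h \<in> H0 \<Longrightarrow> proj (ominus H0 D) h = h - proj D h"
proof (rule proj_eqI)
  show "csubspace (ominus H0 D)"
    using closed_csubspace_ominus[OF H0] by (simp add: closed_csubspace_iff)
  assume "h \<in> H0"
  then show "h - proj D h \<in> ominus H0 D"
    by (rule diff_proj_mem_ominus[OF D(1) H0 D(2)])
  show "cinner (h - (h - proj D h)) s = 0" if "s \<in> ominus H0 D" for s
    using that proj_mem[OF D(1), of h] cinner_commute[of "proj D h" s] by (auto simp: ominus_def)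
qed

lemma i_C0: "h \<in> H0 \<Longrightarrow> i (C0 h) = h - proj D h"
  and C0_mem: "C0 h \<in> E"
proof -
  have mem: "proj (ominus H0 D) h \<in> ominus H0 D" for h
    by (rule proj_mem[OF closed_csubspace_ominus[OF H0]])
  show "C0 h \<in> E"
    unfolding C0 univ_C_def by (rule hadjoint_unitary_mem[OF i csub(4) mem])
  show "i (C0 h) = h - proj D h" if "h \<in> H0"
    unfolding C0 univ_C_def by (subst unitary_apply_hadjoint[OF i csub(4) mem]) (rule proj_ominus[OF that])
qed

lemma bounded_A0: "bounded_op H0 H0 A0"
proof -
  have "clinear_on H0 A0"
    unfolding A0
    by (rule clinear_on_compose[OF clinear_on_proj[OF D(1)] unitary_opD(1)[OF V]])
      (use proj_mem[OF D(1)] in auto)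
  moreover have "A0 ` H0 \<subseteq> H0"
    using unitary_opD(2)[OF V proj_mem[OF D(1)]] Ds by (auto simp: A0)
  moreover have "norm (A0 h) \<le> 1 * norm h" for h
    using unitary_opD(5)[OF V proj_mem[OF D(1)], of h] norm_proj_le[OF D(1), of h] by (simp add: A0)
  ultimately show ?thesis
    unfolding bounded_op_def by blast
qed

lemma bounded_j: "bounded_op F H0 j"
  using unitary_opD(1,2,5)[OF j] unfolding bounded_op_def
  by (auto simp: ominus_def intro!: exI[of _ 1])

lemma bounded_C0: "bounded_op H0 E C0"
proof -
  note S = closed_csubspace_ominus[OF H0, of D]
  note u = unitary_op_hadjoint[OF i csub(4)]
  have "clinear_on H0 C0"
    unfolding C0 univ_C_def[abs_def]
    by (rule clinear_on_compose[OF clinear_on_proj[OF S] unitary_opD(1)[OF u]])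
      (use proj_mem[OF S] in auto)
  moreover have "norm (C0 h) \<le> 1 * norm h" for h
    using unitary_opD(5)[OF u proj_mem[OF S], of h] norm_proj_le[OF S, of h]
    by (simp add: C0 univ_C_def)
  ultimately show ?thesis
    using C0_mem unfolding bounded_op_def by blast
qed

lemma cinner_H0_decomp:
  assumes "h \<in> H0" "h' \<in> H0"
  shows "cinner h h' = cinner (proj D h) (proj D h') + cinner (C0 h) (C0 h')"
proof -
  have "cinner (C0 h) (C0 h') = cinner (h - proj D h) (h' - proj D h')"
    using unitary_opD(4)[OF i C0_mem C0_mem, of h h'] by (simp add: i_C0 assms)
  also have "\<dots> = cinner h h' - cinner (proj D h) (proj D h')"
    using cinner_proj[OF D(1) proj_mem[OF D(1)], of h h'] cinner_proj'[OF D(1) proj_mem[OF D(1)], of h h']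
    by (simp add: cinner_diff_left cinner_diff_right)
  finally show ?thesis by simp
qed

text \<open>The \<open>D\<close>-part of \<open>h\<close> goes to \<open>Ds\<close> by
  \<open>V\<close>. Its defect part, read as the label \<open>C0 h\<close>, passes with
  \<open>g\<close> through the unitary \<open>?G\<close>, and the resulting label is placed by
  \<open>j\<close> orthogonally to \<open>Ds\<close>. So the loop is an orthogonal sum of
  unitaries.\<close>

lemma unitary_closed_loop:
  assumes U1: "unitary_colligation H1 E F A1 B1 C1 D1"
  shows "unitary_op (H0 \<times> H1) (H0 \<times> H1) (closed_loop A0 j C0 A1 B1 C1 D1)"
proof -
  let ?G = "\<lambda>(h, e). (A1 h + B1 e, C1 h + D1 e)"
  have G: "unitary_op (H1 \<times> E) (H1 \<times> F) ?G"
    and bd: "bounded_op H1 H1 A1" "bounded_op E H1 B1" "bounded_op H1 F C1" "bounded_op E F D1"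
    and H1: "closed_csubspace H1"
    using U1 by (auto simp: unitary_colligation_def)
  note GD = unitary_opD[OF G]
  have subH1: "csubspace H1" using H1 by (simp add: closed_csubspace_iff)
  let ?W = "closed_loop A0 j C0 A1 B1 C1 D1"
  have dF: "C1 g + D1 (C0 h) \<in> F" if "g \<in> H1" for g h
    using that by (intro csubspaceD[OF csub(5)] bounded_opD(2)[OF bd(3)] bounded_opD(2)[OF bd(4)] C0_mem)
  have lin: "clinear_on (H0 \<times> H1) ?W"
    unfolding clinear_on_def closed_loop_def
    by (auto simp: clinear_onD[OF bounded_opD(1)[OF bounded_A0]] clinear_onD[OF bounded_opD(1)[OF bounded_C0]]
        clinear_onD[OF bounded_opD(1)[OF bd(1)]] clinear_onD[OF bounded_opD(1)[OF bd(2)]]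
        clinear_onD[OF bounded_opD(1)[OF bd(3)]] clinear_onD[OF bounded_opD(1)[OF bd(4)]]
        clinear_onD(1)[OF unitary_opD(1)[OF j] dF dF, symmetric]
        clinear_onD(2)[OF unitary_opD(1)[OF j] dF, symmetric] C0_mem
        scaleC_prod_def scaleC_add_right algebra_simps)
  have inner: "cinner (?W p) (?W q) = cinner p q" if pq: "p \<in> H0 \<times> H1" "q \<in> H0 \<times> H1" for p q
  proof -
    obtain h g h' g' where p: "p = (h, g)" "h \<in> H0" "g \<in> H1" and q: "q = (h', g')" "h' \<in> H0" "g' \<in> H1"
      using pq by auto
    let ?d = "C1 g + D1 (C0 h)" and ?d' = "C1 g' + D1 (C0 h')"
    have VDs: "V (proj D x) \<in> Ds" for x
      by (rule unitary_opD(2)[OF V proj_mem[OF D(1)]])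
    \<comment> \<open>\<open>V\<close> lands in \<open>Ds\<close> and \<open>j\<close> in its
      complement, so the cross terms vanish.\<close>
    have j0: "cinner (j y) z = 0" "cinner z (j y) = 0" if "y \<in> F" "z \<in> Ds" for y z
    proof -
      show *: "cinner (j y) z = 0"
        using unitary_opD(2)[OF j that(1)] that(2) by (simp add: ominus_def)
      show "cinner z (j y) = 0"
        using * cinner_commute[of z "j y"] by simp
    qed
    have "cinner (?G (g, C0 h)) (?G (g', C0 h')) = cinner (g, C0 h) (g', C0 h')"
      using p q C0_mem by (intro GD(4)) auto
    then show ?thesis
      using p q
      by (simp add: closed_loop_def cinner_prod_def cinner_H0_decomp[OF p(2) q(2)] A0
          cinner_add_left cinner_add_right[of "V _"] cinner_add_right[of "j _"]
          j0 dF VDs unitary_opD(4)[OF V proj_mem[OF D(1)] proj_mem[OF D(1)]]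
          unitary_opD(4)[OF j dF dF] add_ac)
  qed
  have "?W ` (H0 \<times> H1) = H0 \<times> H1"
  proof
    show "?W ` (H0 \<times> H1) \<subseteq> H0 \<times> H1"
      by (auto simp: closed_loop_def intro!: csubspaceD[OF csub(1)] csubspaceD[OF subH1]
          bounded_opD(2)[OF bounded_A0] bounded_opD(2)[OF bounded_j] dF C0_mem
          bounded_opD(2)[OF bd(1)] bounded_opD(2)[OF bd(2)])
    show "H0 \<times> H1 \<subseteq> ?W ` (H0 \<times> H1)"
    proof
      fix y assume "y \<in> H0 \<times> H1"
      then obtain h g where y: "y = (h, g)" "h \<in> H0" "g \<in> H1" by auto
      \<comment> \<open>The loop is solved backwards: \<open>h\<close> splits along
        \<open>Ds\<close> into \<open>V p\<close> and \<open>j d\<close>, then \<open>?G\<close> is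
        inverted at \<open>(g, d)\<close> to give the old \<open>g0\<close> and the label
        \<open>e\<close> of the missing defect part.\<close>
      obtain p where p: "p \<in> D" "V p = proj Ds h"
        using unitary_opD(3)[OF V proj_mem[OF Ds(1)]] by blast
      obtain d where d: "d \<in> F" "j d = h - proj Ds h"
        using unitary_opD(3)[OF j diff_proj_mem_ominus[OF Ds(1) H0 Ds(2) y(2)]] by blast
      obtain q where q: "q \<in> H1 \<times> E" "?G q = (g, d)"
        using GD(3)[of "(g, d)"] y d by auto
      obtain g0 e where ge: "q = (g0, e)" "g0 \<in> H1" "e \<in> E" using q by auto
      have ie: "i e \<in> ominus H0 D" by (rule unitary_opD(2)[OF i ge(3)])
      then have hH: "p + i e \<in> H0"
        using p D by (auto simp: ominus_def intro!: csubspaceD[OF csub(1)])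
      have pr: "proj D (p + i e) = p"
        using ie by (intro proj_eqI csub p) (auto simp: ominus_def)
      have "i (C0 (p + i e)) = i e"
        by (simp add: i_C0[OF hH] pr)
      then have "C0 (p + i e) = e"
        using hadjoint_unitary_apply[OF i csub(4)] C0_mem ge(3) by metis
      then have "?W (p + i e, g0) = y"
        using q ge d p y by (simp add: closed_loop_def A0 pr)
      then show "y \<in> ?W ` (H0 \<times> H1)"
        using hH ge by (intro image_eqI[of _ _ "(p + i e, g0)"]) auto
    qed
  qed
  with lin inner show ?thesis
    unfolding unitary_op_def by blast
qed

text \<open>\<open>U\<close> takes the copy of \<open>D\<close> onto that of \<open>Ds\<close>,
  hence also their complements in \<open>K\<close> onto each other. In the coordinates
  \<open>?H1 \<times> E\<close> and \<open>?H1 \<times> F\<close> this restriction is the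
  colligation sought.\<close>

lemma coupling_colligation:
  fixes K :: "'k::chilbert_space set"
  assumes K: "closed_csubspace K" and U: "unitary_op K K U"
    and \<iota>: "unitary_op H0 L \<iota>" "L \<subseteq> K" and UV: "\<And>h. h \<in> D \<Longrightarrow> U (\<iota> h) = \<iota> (V h)"
  shows "\<exists>A1 B1 C1 D1. unitary_colligation (ominus K L) E F A1 B1 C1 D1 \<and>
    (\<forall>h\<in>H0. \<forall>g\<in>ominus K L. \<forall>h' g'. closed_loop A0 j C0 A1 B1 C1 D1 (h, g) = (h', g') \<longrightarrow>
       h' \<in> H0 \<and> g' \<in> ominus K L \<and> U (\<iota> h + g) = \<iota> h' + g')"
proof -
  let ?H1 = "ominus K L"
  have H1: "closed_csubspace ?H1" by (rule closed_csubspace_ominus[OF K])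
  then have subH1: "csubspace ?H1" and subK: "csubspace K"
    using K by (auto simp: closed_csubspace_iff)
  let ?\<Phi> = "\<lambda>(h, e). h + \<iota> (i e)" and ?\<Psi> = "\<lambda>(h, d). h + \<iota> (j d)"
  note \<Phi> = unitary_op_orthogonal_sum[OF K H0 \<iota> D(2) i]
  note \<Psi> = unitary_op_orthogonal_sum[OF K H0 \<iota> Ds(2) j]
  have \<iota>DK: "\<iota> ` D \<subseteq> K"
    using unitary_opD(2)[OF \<iota>(1)] D(2) \<iota>(2) by auto
  have "U ` \<iota> ` D = \<iota> ` Ds"
    using V UV by (force simp: unitary_op_def image_iff)
  then have UN: "unitary_op (ominus K (\<iota> ` D)) (ominus K (\<iota> ` Ds)) U"
    using unitary_op_ominus[OF U \<iota>DK] by simp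
  \<comment> \<open>The inverse of \<open>?\<Psi>\<close>, which turns a vector orthogonal to the
    copy of \<open>Ds\<close> into its coordinates.\<close>
  define \<Psi>' where "\<Psi>' = hadjoint (?H1 \<times> F) ?\<Psi>"
  have sub: "csubspace (?H1 \<times> F)" by (rule csubspace_Times[OF subH1 csub(5)])
  define G where "G = (\<lambda>p. \<Psi>' (U (?\<Phi> p)))"
  have G: "unitary_op (?H1 \<times> E) (?H1 \<times> F) G"
    unfolding G_def \<Psi>'_def
    by (rule unitary_op_compose[OF unitary_op_compose[OF \<Phi> UN] unitary_op_hadjoint[OF \<Psi> sub]])
  have \<Psi>G: "?\<Psi> (G p) = U (?\<Phi> p)" if "p \<in> ?H1 \<times> E" for p
    unfolding G_def \<Psi>'_def
    by (rule unitary_apply_hadjoint[OF \<Psi> sub unitary_opD(2)[OF UN unitary_opD(2)[OF \<Phi> that]]])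
  let ?A1 = "\<lambda>h. fst (G (h, 0))" and ?B1 = "\<lambda>e. fst (G (0, e))"
    and ?C1 = "\<lambda>h. snd (G (h, 0))" and ?D1 = "\<lambda>e. snd (G (0, e))"
  have col: "unitary_colligation ?H1 E F ?A1 ?B1 ?C1 ?D1"
    by (rule unitary_colligation_of_unitary[OF H1 csub(4,5) G])
  have loop: "h' \<in> H0 \<and> g' \<in> ?H1 \<and> U (\<iota> h + g) = \<iota> h' + g'"
    if h: "h \<in> H0" and g: "g \<in> ?H1" and hg: "closed_loop A0 j C0 ?A1 ?B1 ?C1 ?D1 (h, g) = (h', g')"
    for h g h' g'
  proof -
    have z: "0 \<in> ?H1" "0 \<in> E"
      using csubspaceD(1)[OF subH1] csubspaceD(1)[OF csub(4)] .
    have "G (g, 0) + G (0, C0 h) = G (g, C0 h)"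
      using clinear_onD(1)[OF unitary_opD(1)[OF G], of "(g, 0)" "(0, C0 h)"] g z C0_mem[of h] by simp
    then have gd: "fst (G (g, 0)) + fst (G (0, C0 h)) = fst (G (g, C0 h))"
      "snd (G (g, 0)) + snd (G (0, C0 h)) = snd (G (g, C0 h))"
      by (metis fst_add, metis snd_add)
    have Gm: "G (g, C0 h) \<in> ?H1 \<times> F"
      using g C0_mem by (intro unitary_opD(2)[OF G]) auto
    define d where "d = snd (G (g, C0 h))"
    have eq: "h' = A0 h + j d" "g' = fst (G (g, C0 h))"
      using hg by (auto simp: closed_loop_def gd d_def)
    have dF: "d \<in> F" using Gm by (auto simp: d_def mem_Times_iff)
    have jd: "j d \<in> H0" by (rule bounded_opD(2)[OF bounded_j dF])
    have Ah: "A0 h \<in> H0" by (rule bounded_opD(2)[OF bounded_A0 h])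
    have pD: "proj D h \<in> D" by (rule proj_mem[OF D(1)])
    then have pH: "proj D h \<in> H0" using D by auto
    have iH: "i (C0 h) \<in> H0"
      using unitary_opD(2)[OF i C0_mem[of h]] by (simp add: ominus_def)
    have \<iota>K: "\<iota> x \<in> K" if "x \<in> H0" for x
      using unitary_opD(2)[OF \<iota>(1) that] \<iota>(2) by auto
    have gK: "g \<in> K" using g by (simp add: ominus_def)
    \<comment> \<open>The vector is split along the copy of \<open>D\<close>, where \<open>U\<close>
      is \<open>V\<close>, and its complement, where \<open>U\<close> is \<open>G\<close> in
      coordinates.\<close>
    have "\<iota> h = \<iota> (proj D h) + \<iota> (i (C0 h))"
      using clinear_onD(1)[OF unitary_opD(1)[OF \<iota>(1)] pH iH] by (simp add: i_C0[OF h])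
    then have "\<iota> h + g = \<iota> (proj D h) + ?\<Phi> (g, C0 h)"
      by simp
    then have "U (\<iota> h + g) = U (\<iota> (proj D h)) + U (?\<Phi> (g, C0 h))"
      using \<iota>K[OF pH] \<iota>K[OF iH] gK
      by (simp only: clinear_onD(1)[OF unitary_opD(1)[OF U]] prod.case csubspaceD(2)[OF subK])
    also have "\<dots> = \<iota> (A0 h) + ?\<Psi> (G (g, C0 h))"
      using g C0_mem by (simp only: UV[OF pD] A0 \<Psi>G mem_Times_iff fst_conv snd_conv)
    also have "\<dots> = \<iota> h' + g'"
      using clinear_onD(1)[OF unitary_opD(1)[OF \<iota>(1)] Ah jd]
      by (simp add: eq d_def split_beta)
    finally show ?thesis
      using Gm csubspaceD(2)[OF csub(1) Ah jd] by (auto simp: eq mem_Times_iff)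
  qed
  show ?thesis
    using col loop by blast
qed

end


section \<open>The universal colligation\<close>

locale lifting_setting =
  fixes U' :: "'a::chilbert_space \<Rightarrow> 'a" and U'' :: "'b::chilbert_space \<Rightarrow> 'b"
    and X :: "'a \<Rightarrow> 'b" and Kp :: "'a set" and Km :: "'b set"
    and H0 :: "'h::chilbert_space set" and J :: "'b \<times> 'a \<Rightarrow> 'h"
    and E :: "'d::chilbert_space set" and i :: "'d \<Rightarrow> 'h"
    and F :: "'s::chilbert_space set" and j :: "'s \<Rightarrow> 'h"
  assumes data: "lifting_data X U' U'' Kp Km"
    and completion: "gram_completion X Kp Km H0 J"
    and E: "closed_csubspace E" "unitary_op E (ominus H0 (univ_dom U' Kp Km J)) i"
    and F: "closed_csubspace F" "unitary_op F (ominus H0 (univ_ran U'' Kp Km J)) j"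
begin

abbreviation "R' \<equiv> hadjoint UNIV U'"
abbreviation "R'' \<equiv> hadjoint UNIV U''"
abbreviation "D \<equiv> univ_dom U' Kp Km J"
abbreviation "Ds \<equiv> univ_ran U'' Kp Km J"
abbreviation "V \<equiv> univ_V U' U'' Kp Km J"
abbreviation "A0 \<equiv> univ_A U' U'' Kp Km J"
abbreviation "C0 \<equiv> univ_C (ominus H0 D) E i"

lemma U': "unitary_op UNIV UNIV U'" and U'': "unitary_op UNIV UNIV U''"
  and Kp: "closed_csubspace Kp" and Km: "closed_csubspace Km"
  and subKp: "csubspace Kp" and subKm: "csubspace Km"
  and U'Kp: "k \<in> Kp \<Longrightarrow> U' k \<in> Kp" and R''Km: "m \<in> Km \<Longrightarrow> R'' m \<in> Km"
  and X_lin: "clinear_on Kp X" and X_mem: "k \<in> Kp \<Longrightarrow> X k \<in> Km"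
  and X_norm: "k \<in> Kp \<Longrightarrow> norm (X k) \<le> norm k"
  and X_U': "k \<in> Kp \<Longrightarrow> X (U' k) = proj Km (U'' (X k))"
  and cyclic: "star_cyclic U' Kp" "star_cyclic U'' Km"
  using data by (auto simp: lifting_data_def contraction_op_def closed_csubspace_iff)

lemma R': "unitary_op UNIV UNIV R'" and R'': "unitary_op UNIV UNIV R''"
  using unitary_op_hadjoint[OF U' csubspace_UNIV] unitary_op_hadjoint[OF U'' csubspace_UNIV] .

lemma adjoint_inverse [simp]: "U' (R' x) = x" "R' (U' x) = x" "U'' (R'' y) = y" "R'' (U'' y) = y"
  using unitary_apply_hadjoint[OF U' csubspace_UNIV] hadjoint_unitary_apply[OF U' csubspace_UNIV]
    unitary_apply_hadjoint[OF U'' csubspace_UNIV] hadjoint_unitary_apply[OF U'' csubspace_UNIV]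
  by auto

lemma X_intertwine: "k \<in> Kp \<Longrightarrow> m \<in> Km \<Longrightarrow> cinner (X (U' k)) m = cinner (X k) (R'' m)"
  by (simp add: X_U' cinner_proj[OF Km] unitary_adjoint(1)[OF U''])

lemma U'_pow_Kp: "k \<in> Kp \<Longrightarrow> (U' ^^ n) k \<in> Kp"
  by (induction n) (auto intro: U'Kp)

lemma H0: "closed_csubspace H0" and J_lin: "clinear_on (Km \<times> Kp) J"
  and H0_eq: "H0 = closure (J ` (Km \<times> Kp))"
  using completion by (auto simp: gram_completion_def)

lemma J_mem: "m \<in> Km \<Longrightarrow> k \<in> Kp \<Longrightarrow> J (m, k) \<in> H0"
  unfolding H0_eq by (rule subsetD[OF closure_subset]) auto

lemma subKK: "csubspace (Km \<times> Kp)"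
  by (rule csubspace_Times[OF subKm subKp])

lemma zero_mem: "0 \<in> Km" "0 \<in> Kp"
  using csubspaceD(1)[OF subKm] csubspaceD(1)[OF subKp] .

lemma cinner_J:
  assumes "m \<in> Km" "k \<in> Kp" "m' \<in> Km" "k' \<in> Kp"
  shows "cinner (J (m, k)) (J (m', k')) =
    cinner m m' + cinner (X k) m' + cinner m (X k') + cinner k k'"
proof -
  have "cinner k' (hadjoint Kp X m) = cinner (X k') m"
    by (rule cinner_hadjoint[OF Kp X_lin, of 1]) (use X_norm assms in auto)
  then have "cinner (hadjoint Kp X m) k' = cinner m (X k')"
    by (metis cinner_commute)
  then show ?thesis
    using completion assms
    by (simp add: gram_completion_def cinner_prod_def cinner_add_left)
qed

text \<open>The intertwining relation of \<open>X\<close> is exactly the equality of the cross terms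
  of the two Gram forms; the diagonal terms agree since \<open>U'\<close> and \<open>R''\<close> are
  isometric.\<close>

lemma norm_J_shift:
  assumes "m \<in> Km" "k \<in> Kp"
  shows "norm (J (m, U' k)) = norm (J (R'' m, k))"
proof (rule norm_eq_if_cinner_self_eq)
  have *: "cinner m (X (U' k)) = cinner (R'' m) (X k)"
    using X_intertwine[OF assms(2,1)] by (metis cinner_commute)
  show "cinner (J (m, U' k)) (J (m, U' k)) = cinner (J (R'' m, k)) (J (R'' m, k))"
    using assms
    by (simp add: cinner_J U'Kp R''Km X_intertwine * unitary_opD(4)[OF U'] unitary_opD(4)[OF R''])
qed

lemma J_shift_lin:
  shows "clinear_on (Km \<times> Kp) (\<lambda>(m, k). J (m, U' k))" "clinear_on (Km \<times> Kp) (\<lambda>(m, k). J (R'' m, k))"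
proof -
  note lin = clinear_onD[OF unitary_opD(1)[OF U']] clinear_onD[OF unitary_opD(1)[OF R'']]
  have add: "J (m + m', k + k') = J (m, k) + J (m', k')"
    if "m \<in> Km" "k \<in> Kp" "m' \<in> Km" "k' \<in> Kp" for m k m' k'
    using clinear_onD(1)[OF J_lin, of "(m, k)" "(m', k')"] that by simp
  have scale: "J (c *\<^sub>C m, c *\<^sub>C k) = c *\<^sub>C J (m, k)" if "m \<in> Km" "k \<in> Kp" for c m k
    using clinear_onD(2)[OF J_lin, of "(m, k)" c] that by (simp add: scaleC_prod_def)
  show "clinear_on (Km \<times> Kp) (\<lambda>(m, k). J (m, U' k))" "clinear_on (Km \<times> Kp) (\<lambda>(m, k). J (R'' m, k))"
    unfolding clinear_on_def by (auto simp: lin add scale U'Kp R''Km scaleC_prod_def)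
qed

text \<open>Both spaces become closures of images of the same \<open>Km \<times> Kp\<close>, the
  form in which \<open>unitary_between_closures\<close> can be applied.\<close>

lemma D_eq: "D = closure ((\<lambda>(m, k). J (m, U' k)) ` (Km \<times> Kp))"
  and Ds_eq: "Ds = closure ((\<lambda>(m, k). J (R'' m, k)) ` (Km \<times> Kp))"
proof -
  have "J ` (Km \<times> U' ` Kp) = (\<lambda>(m, k). J (m, U' k)) ` (Km \<times> Kp)"
    "J ` (R'' ` Km \<times> Kp) = (\<lambda>(m, k). J (R'' m, k)) ` (Km \<times> Kp)"
    by (auto simp: image_iff)
  then show "D = closure ((\<lambda>(m, k). J (m, U' k)) ` (Km \<times> Kp))"
    "Ds = closure ((\<lambda>(m, k). J (R'' m, k)) ` (Km \<times> Kp))"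
    by (simp_all add: univ_dom_def univ_ran_def)
qed

lemma D_mem: "m \<in> Km \<Longrightarrow> k \<in> Kp \<Longrightarrow> J (m, U' k) \<in> D"
  unfolding D_eq by (rule subsetD[OF closure_subset]) auto

text \<open>By \<open>norm_J_shift\<close> the choice in \<open>univ_V\<close> has a witness, so its
  specification may be used.\<close>

lemma V: "unitary_op D Ds V" and V_J: "m \<in> Km \<Longrightarrow> k \<in> Kp \<Longrightarrow> V (J (m, U' k)) = J (R'' m, k)"
proof -
  have "\<exists>V. unitary_op D Ds V \<and> (\<forall>p\<in>Km \<times> Kp. V ((\<lambda>(m, k). J (m, U' k)) p) = (\<lambda>(m, k). J (R'' m, k)) p)"
    unfolding D_eq Ds_eq
    by (rule unitary_between_closures[OF subKK J_shift_lin]) (auto intro: norm_J_shift)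
  then have "\<exists>V. unitary_op D Ds V \<and> (\<forall>m\<in>Km. \<forall>k\<in>Kp. V (J (m, U' k)) = J (R'' m, k))"
    by auto
  from someI_ex[OF this] show "unitary_op D Ds V" "m \<in> Km \<Longrightarrow> k \<in> Kp \<Longrightarrow> V (J (m, U' k)) = J (R'' m, k)"
    unfolding univ_V_def by auto
qed

lemma colligation: "isometric_colligation H0 D Ds V E i F j A0 C0"
proof
  show "closed_csubspace D" "closed_csubspace Ds"
    unfolding D_eq Ds_eq by (intro closed_csubspace_closure csubspace_image[OF _ subKK] J_shift_lin)+
  show "D \<subseteq> H0" "Ds \<subseteq> H0"
    unfolding univ_dom_def univ_ran_def H0_eq by (intro closure_mono; use U'Kp R''Km in auto)+
qed (simp_all add: H0 V E F univ_A_def)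

sublocale isometric_colligation H0 D Ds V E i F j A0 C0
  by (rule colligation)

lemma adjoint_A0_pow: "k \<in> Kp \<Longrightarrow> (hadjoint H0 A0 ^^ n) (J (0, k)) = J (0, (U' ^^ n) k)"
proof (induction n)
  case (Suc n)
  have step: "hadjoint H0 A0 (J (0, k)) = J (0, U' k)" if k: "k \<in> Kp" for k
  proof (rule hadjoint_eqI[OF csub(1)])
    show "J (0, U' k) \<in> H0"
      using k by (intro J_mem zero_mem U'Kp)
    have Dm: "J (0, U' k) \<in> D"
      by (rule D_mem[OF zero_mem(1) k])
    have VJ: "V (J (0, U' k)) = J (0, k)"
      using V_J[OF zero_mem(1) k] clinear_on_zero[OF unitary_opD(1)[OF R''] csubspace_UNIV] by simp
    fix z assume "z \<in> H0"
    have "cinner (A0 z) (J (0, k)) = cinner (proj D z) (J (0, U' k))"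
      unfolding univ_A_def VJ[symmetric]
      by (rule unitary_opD(4)[OF V proj_mem[OF D(1)] Dm])
    also have "\<dots> = cinner z (J (0, U' k))"
      by (rule cinner_proj[OF D(1) Dm])
    finally show "cinner (A0 z) (J (0, k)) = cinner z (J (0, U' k))" .
  qed
  show ?case
    using Suc step[OF U'_pow_Kp[OF Suc.prems, of n]] by simp
qed simp

section \<open>Symbols of lifts in terms of loop trajectories\<close>

lemma lift_cinner:
  assumes Y: "contractive_intertwining_lift X U' U'' Kp Km Y" and "k \<in> Kp" "m \<in> Km"
  shows "cinner m (Y k) = cinner m (X k)" "cinner (Y k) m = cinner (X k) m"
  using Y assms(2,3) cinner_proj'[OF Km assms(3), of "Y k"] cinner_proj[OF Km assms(3), of "Y k"]
  by (auto simp: contractive_intertwining_lift_def)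

lemma lift_R':
  assumes "contractive_intertwining_lift X U' U'' Kp Km Y"
  shows "Y (R' k) = R'' (Y k)"
proof -
  have "Y (U' (R' k)) = U'' (Y (R' k))"
    using assms by (simp only: contractive_intertwining_lift_def)
  then have "R'' (Y k) = R'' (U'' (Y (R' k)))"
    by simp
  then show ?thesis by simp
qed

text \<open>\<open>traj\<close> is the only link between \<open>Y\<close> and the colligation, and
  each implication supplies it in its own way. The compressions to \<open>G''\<close>, taken from
  \<open>H0\<close> and from the space of \<open>U''\<close>, are compared by
  \<open>hadjoint_cong\<close>.\<close>

lemma symbol_eq_symbol_column:
  assumes Y: "contractive_intertwining_lift X U' U'' Kp Km Y"
    and U1: "unitary_colligation H1 E F A1 B1 C1 D1"
    and traj: "\<And>n m k. m \<in> Km \<Longrightarrow> k \<in> Kp \<Longrightarrow>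
      cinner (J (m, 0)) (fst ((closed_loop A0 j C0 A1 B1 C1 D1 ^^ n) (J (0, k), 0)))
      = cinner m (Y ((R' ^^ n) k))"
    and G'': "G'' \<subseteq> Km" and g: "g \<in> Kp"
  shows "symbol_column G'' J H0 F A0 j C0 (io_map A1 B1 C1 D1) n g = symbol U'' G'' Y n g"
  unfolding symbol_column_def symbol_def
proof (rule hadjoint_cong)
  fix z assume "z \<in> G''"
  then have z: "z \<in> Km" using G'' by auto
  show "cinner (J (z, 0))
      (if n < 0 then S0_minus H0 A0 (J (0, g)) n
       else S0_plus A0 (J (0, g)) (nat n) + S2_plus A0 j
         (feedback_inv F (\<lambda>d. io_map A1 B1 C1 D1 (S_plus A0 j C0 d))
           (io_map A1 B1 C1 D1 (S1_plus A0 C0 (J (0, g))))) (nat n)) =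
    cinner z (adj_power U'' n (Y g))"
  proof (cases "n < 0")
    case True
    \<comment> \<open>Intertwining moves the powers onto \<open>g\<close>, where they stay in
      \<open>Kp\<close>; tested against \<open>Km\<close>, \<open>Y\<close> is then seen only
      through \<open>X\<close>.\<close>
    have "(U'' ^^ m) (Y g) = Y ((U' ^^ m) g)" for m
      using Y by (induction m) (simp_all add: contractive_intertwining_lift_def)
    moreover have "nat \<bar>n\<bar> = nat (- n)" using True by simp
    ultimately show ?thesis
      using True z g zero_mem U'_pow_Kp[OF g]
      by (simp add: S0_minus_def adj_power_def adjoint_A0_pow cinner_J lift_cinner[OF Y]
          clinear_on_zero[OF X_lin subKp])
  next
    case False
    have bd: "bounded_op H1 H1 A1" "bounded_op E H1 B1" "bounded_op H1 F C1" "bounded_op E F D1"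
      and H1: "csubspace H1"
      using U1 by (auto simp: unitary_colligation_def closed_csubspace_iff)
    have "(R'' ^^ m) (Y g) = Y ((R' ^^ m) g)" for m
      by (induction m) (simp_all add: lift_R'[OF Y])
    then show ?thesis
      using False traj[OF z g, of "nat n"]
      by (simp add: adj_power_def closed_loop_trajectory[OF csub(1) H1 bounded_A0 bounded_j bounded_C0
            bd csub(5) J_mem[OF zero_mem(1) g]])
  qed
qed


section \<open>From lifts to colligations\<close>

lemma colligation_of_lift:
  assumes Y: "contractive_intertwining_lift X U' U'' Kp Km Y"
  shows "\<exists>(H1 :: ('b \<times> 'a) set) A1 B1 C1 D1. unitary_colligation H1 E F A1 B1 C1 D1 \<and>
    (\<forall>n. \<forall>m\<in>Km. \<forall>k\<in>Kp.
      cinner (J (m, 0)) (fst ((closed_loop A0 j C0 A1 B1 C1 D1 ^^ n) (J (0, k), 0)))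
      = cinner m (Y ((R' ^^ n) k)))"
proof -
  have Yc: "contraction_op UNIV UNIV Y"
    using Y by (simp add: contractive_intertwining_lift_def)
  then have Ylin: "clinear_on UNIV Y"
    by (simp add: contraction_op_def)
  obtain Q :: "'a \<Rightarrow> 'a" where Q: "clinear_on UNIV Q"
      "\<And>x y. cinner (Q x) (Q y) = cinner x y - cinner (Y x) (Y y)"
    using defect_operator_ex[OF Yc] by blast
  define W where "W = (\<lambda>(m, k). (m + Y k, Q k))"
  define K where "K = closure (range W)"
  have Wlin: "clinear_on S W" for S
    unfolding clinear_on_def W_def
    by (auto simp: clinear_onD[OF Ylin] clinear_onD[OF Q(1)] scaleC_prod_def scaleC_add_right)
  \<comment> \<open>The term <Y k, Y k'> from the first coordinate cancels against the one from
    \<open>Q\<close>, leaving the Gram form of \<open>Y\<close>.\<close>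
  have cW: "cinner (W (m, k)) (W (m', k')) =
      cinner m m' + cinner (Y k) m' + cinner m (Y k') + cinner k k'" for m k m' k'
    by (simp add: W_def cinner_prod_def Q(2) cinner_add_left cinner_add_right)
  have K: "closed_csubspace K"
    unfolding K_def by (intro closed_csubspace_closure csubspace_image[OF Wlin csubspace_UNIV])
  have subK: "csubspace K" using K by (simp add: closed_csubspace_iff)
  have WK: "W p \<in> K" for p
    unfolding K_def by (rule subsetD[OF closure_subset]) auto

  \<comment> \<open>\<open>S\<close> is the dilation \<open>U\<close> before passing to the closure;
    it preserves the form of \<open>W\<close> because \<open>Y\<close> also intertwines the
    adjoints.\<close>
  define S where "S = (\<lambda>(m, k). (R'' m, R' k))"
  have "range S = UNIV"
  proof -
    have "p = S (U'' (fst p), U' (snd p))" for p by (simp add: S_def)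
    then show ?thesis by (metis UNIV_eq_I rangeI)
  qed
  then have ran: "range (\<lambda>p. W (S p)) = range W"
    by (metis image_image)
  have Slin: "clinear_on UNIV (\<lambda>p. W (S p))"
  proof (rule clinear_on_compose[OF _ Wlin[of UNIV]])
    show "clinear_on UNIV S"
      unfolding S_def clinear_on_def
      by (auto simp: clinear_onD[OF unitary_opD(1)[OF R']] clinear_onD[OF unitary_opD(1)[OF R'']] scaleC_prod_def)
  qed simp
  have "norm (W p) = norm (W (S p))" for p
  proof (rule norm_eq_if_cinner_self_eq)
    show "cinner (W p) (W p) = cinner (W (S p)) (W (S p))"
      by (cases p) (simp add: S_def cW lift_R'[OF Y] unitary_opD(4)[OF R'] unitary_opD(4)[OF R''])
  qed
  then obtain U where U: "unitary_op K K U" and UW: "\<And>p. U (W p) = W (S p)"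
    using unitary_between_closures[OF csubspace_UNIV Wlin Slin] by (auto simp: K_def ran)

  define L where "L = closure (W ` (Km \<times> Kp))"
  have LK: "L \<subseteq> K" unfolding L_def K_def by (intro closure_mono) auto
  \<comment> \<open>On \<open>Km\<close> and \<open>Kp\<close> the Gram forms of \<open>Y\<close>
    and \<open>X\<close> coincide, so \<open>H0\<close> embeds into \<open>K\<close>.\<close>
  have "norm (J p) = norm (W p)" if "p \<in> Km \<times> Kp" for p
  proof (rule norm_eq_if_cinner_self_eq)
    show "cinner (J p) (J p) = cinner (W p) (W p)"
      using that by (cases p) (auto simp: cinner_J cW lift_cinner[OF Y])
  qed
  then obtain \<iota> where \<iota>: "unitary_op H0 L \<iota>" and \<iota>J: "\<And>p. p \<in> Km \<times> Kp \<Longrightarrow> \<iota> (J p) = W p"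
    using unitary_between_closures[OF subKK J_lin Wlin] by (auto simp: L_def H0_eq)

  have UV: "U (\<iota> h) = \<iota> (V h)" if h: "h \<in> D" for h
  proof -
    \<comment> \<open>\<open>V\<close> is known explicitly only on the dense generators of
      \<open>D\<close>; continuity does the rest.\<close>
    let ?f = "\<lambda>h. U (\<iota> h) - \<iota> (V h)"
    have c\<iota>: "continuous_on H0 \<iota>" by (rule unitary_continuous_on[OF \<iota> csub(1)])
    have "continuous_on D (\<lambda>h. U (\<iota> h))"
      using D(2) LK unitary_opD(2)[OF \<iota>]
      by (intro continuous_on_compose2[OF unitary_continuous_on[OF U subK]
            continuous_on_subset[OF c\<iota> D(2)]] image_subsetI) blast
    moreover have "continuous_on D (\<lambda>h. \<iota> (V h))"
      using unitary_opD(2)[OF V] Ds(2)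
      by (intro continuous_on_compose2[OF c\<iota> unitary_continuous_on[OF V csub(2)]]) auto
    ultimately have "continuous_on D ?f"
      by (rule continuous_on_diff)
    moreover have "?f y = 0" if "y \<in> (\<lambda>(m, k). J (m, U' k)) ` (Km \<times> Kp)" for y
      using that by (auto simp: V_J \<iota>J U'Kp R''Km UW S_def)
    ultimately have "?f h = 0"
      using h unfolding D_eq by (rule continuous_constant_on_closure)
    then show ?thesis by simp
  qed

  let ?H1 = "ominus K L"
  obtain A1 B1 C1 D1 where col: "unitary_colligation ?H1 E F A1 B1 C1 D1"
    and loop: "\<And>h g h' g'. h \<in> H0 \<Longrightarrow> g \<in> ?H1 \<Longrightarrow> closed_loop A0 j C0 A1 B1 C1 D1 (h, g) = (h', g') \<Longrightarrow>
       h' \<in> H0 \<and> g' \<in> ?H1 \<and> U (\<iota> h + g) = \<iota> h' + g'"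
    using coupling_colligation[OF K U \<iota> LK UV] by metis
  let ?T = "closed_loop A0 j C0 A1 B1 C1 D1"
  have "cinner (J (m, 0)) (fst ((?T ^^ n) (J (0, k), 0))) = cinner m (Y ((R' ^^ n) k))"
    if m: "m \<in> Km" and k: "k \<in> Kp" for n m k
  proof -
    let ?t = "\<lambda>n. (?T ^^ n) (J (0, k), 0)"
    \<comment> \<open>Invariant: read in \<open>K\<close>, the loop state is the orbit of
      \<open>W (0, k)\<close> under \<open>U\<close>.\<close>
    have t: "fst (?t n) \<in> H0 \<and> snd (?t n) \<in> ?H1 \<and> \<iota> (fst (?t n)) + snd (?t n) = W (0, (R' ^^ n) k)" for n
    proof (induction n)
      case 0
      show ?case
        using k zero_mem J_mem[OF zero_mem(1) k]
          csubspaceD(1)[of ?H1] closed_csubspace_ominus[OF K, of L]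
        by (simp add: \<iota>J closed_csubspace_iff)
    next
      case (Suc n)
      obtain h g where hg: "?t n = (h, g)" by (rule prod.exhaust)
      obtain h' g' where hg': "?T (h, g) = (h', g')" by (rule prod.exhaust)
      have "U (W (0, (R' ^^ n) k)) = W (0, (R' ^^ Suc n) k)"
        using clinear_on_zero[OF unitary_opD(1)[OF R''] csubspace_UNIV] by (simp add: UW S_def)
      then show ?case
        using Suc loop[of h g h' g'] hg' by (simp add: hg)
    qed
    have Jm: "J (m, 0) \<in> H0" by (rule J_mem[OF m zero_mem(2)])
    \<comment> \<open>The second component lies in the complement of \<open>L\<close>, so pairing
      with the copy of \<open>J (m, 0)\<close> sees only the first.\<close>
    have "cinner (\<iota> (J (m, 0))) (snd (?t n)) = 0"
    proof -
      have "cinner (snd (?t n)) (\<iota> (J (m, 0))) = 0"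
        using t[of n] unitary_opD(2)[OF \<iota> Jm] by (simp add: ominus_def)
      then show ?thesis
        using cinner_commute[of "\<iota> (J (m, 0))" "snd (?t n)"] by simp
    qed
    then have "cinner (J (m, 0)) (fst (?t n)) = cinner (\<iota> (J (m, 0))) (\<iota> (fst (?t n)) + snd (?t n))"
      using unitary_opD(4)[OF \<iota> Jm conjunct1[OF t[of n]]] by (simp only: cinner_add_right) simp
    also have "\<dots> = cinner (W (m, 0)) (W (0, (R' ^^ n) k))"
      using t[of n] \<iota>J m zero_mem by simp
    also have "\<dots> = cinner m (Y ((R' ^^ n) k))"
      using clinear_on_zero[OF Ylin csubspace_UNIV] by (simp add: cW)
    finally show ?thesis .
  qed
  with col show ?thesis by blast
qed


section \<open>From colligations to lifts\<close>

lemma lift_of_colligation: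
  fixes H1 :: "'g::chilbert_space set"
  assumes U1: "unitary_colligation H1 E F A1 B1 C1 D1"
  shows "\<exists>Y. contractive_intertwining_lift X U' U'' Kp Km Y \<and>
    (\<forall>n. \<forall>m\<in>Km. \<forall>k\<in>Kp.
      cinner (J (m, 0)) (fst ((closed_loop A0 j C0 A1 B1 C1 D1 ^^ n) (J (0, k), 0)))
      = cinner m (Y ((R' ^^ n) k)))"
proof -
  let ?K = "H0 \<times> H1" and ?T = "closed_loop A0 j C0 A1 B1 C1 D1"
  have T: "unitary_op ?K ?K ?T" by (rule unitary_closed_loop[OF U1])
  have H1: "closed_csubspace H1" and bd: "bounded_op H1 H1 A1" "bounded_op E H1 B1"
      "bounded_op H1 F C1" "bounded_op E F D1"
    using U1 by (auto simp: unitary_colligation_def)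
  then have subH1: "csubspace H1" by (simp add: closed_csubspace_iff)
  note K = closed_csubspace_Times[OF H0 H1]
  have subK: "csubspace ?K" using K by (simp add: closed_csubspace_iff)
  have z1: "0 \<in> H1" by (rule csubspaceD(1)[OF subH1])
  \<comment> \<open>On \<open>D\<close> the output \<open>C0 h\<close> vanishes, so nothing enters
    the second colligation and the loop acts as \<open>V\<close>.\<close>
  have T_D: "?T (h, 0) = (V h, 0)" if h: "h \<in> D" for h
  proof -
    have hH: "h \<in> H0" using h D by auto
    have "cinner (C0 h) (C0 h) = 0"
      using cinner_H0_decomp[OF hH hH] by (simp add: proj_same[OF csub(2) h])
    then have "C0 h = 0" by simp
    then show ?thesis
      using clinear_on_zero[OF bounded_opD(1)[OF bd(1)] subH1] clinear_on_zero[OF bounded_opD(1)[OF bd(2)] csub(4)]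
        clinear_on_zero[OF bounded_opD(1)[OF bd(3)] subH1] clinear_on_zero[OF bounded_opD(1)[OF bd(4)] csub(4)]
        clinear_on_zero[OF unitary_opD(1)[OF j] csub(5)]
      by (simp add: closed_loop_def univ_A_def proj_same[OF csub(2) h])
  qed
  have Jlin: "clinear_on Kp (\<lambda>k. (J (0, k), 0 :: 'g))"
      "clinear_on Km (\<lambda>m. (J (m, 0), 0 :: 'g))"
    using zero_mem clinear_onD(1)[OF J_lin, of "(0, _)" "(0, _)"] clinear_onD(2)[OF J_lin, of "(0, _)"]
      clinear_onD(1)[OF J_lin, of "(_, 0)" "(_, 0)"] clinear_onD(2)[OF J_lin, of "(_, 0)"]
    by (auto simp: clinear_on_def scaleC_prod_def)
  have X0: "X 0 = 0" by (rule clinear_on_zero[OF X_lin subKp])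
  have nJ: "norm (J (0, k), 0 :: 'g) = norm k" if "k \<in> Kp" for k
    by (rule norm_eq_if_cinner_self_eq) (use that zero_mem X0 in \<open>simp add: cinner_prod_def cinner_J\<close>)
  have nJ': "norm (J (m, 0), 0 :: 'g) = norm m" if "m \<in> Km" for m
    by (rule norm_eq_if_cinner_self_eq) (use that zero_mem X0 in \<open>simp add: cinner_prod_def cinner_J\<close>)

  obtain \<Phi>' where \<Phi>': "clinear_on UNIV \<Phi>'" "range \<Phi>' \<subseteq> ?K" "\<And>x. norm (\<Phi>' x) = norm x"
      "\<And>k. k \<in> Kp \<Longrightarrow> \<Phi>' k = (J (0, k), 0)" "\<And>x. ?T (\<Phi>' (U' x)) = \<Phi>' x"
  proof -
    have "?T (J (0, U' k), 0) = (J (0, k), 0)" if "k \<in> Kp" for k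
      using T_D[OF D_mem[OF zero_mem(1) that]] V_J[OF zero_mem(1) that]
        clinear_on_zero[OF unitary_opD(1)[OF R''] csubspace_UNIV] by simp
    then show ?thesis
      using star_cyclic_isometry_extension[OF U' subKp _ cyclic(1) K T, of "\<lambda>k. (J (0, k), 0)"]
        that U'Kp Jlin(1) nJ z1 J_mem zero_mem by (auto simp: image_subset_iff)
  qed
  \<comment> \<open>On the copy of \<open>Kp\<close> the loop undoes \<open>U'\<close>, as the
    extension lemma asks. On that of \<open>Km\<close> it performs \<open>R''\<close> instead of
    undoing it, so the lemma is applied to the inverse loop.\<close>
  define T' where "T' = hadjoint ?K ?T"
  have T': "unitary_op ?K ?K T'"
    unfolding T'_def by (rule unitary_op_hadjoint[OF T subK])
  obtain \<Phi>'' where \<Phi>'': "clinear_on UNIV \<Phi>''" "range \<Phi>'' \<subseteq> ?K" "\<And>x. norm (\<Phi>'' x) = norm x"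
      "\<And>k. k \<in> Km \<Longrightarrow> \<Phi>'' k = (J (k, 0), 0)" "\<And>x. T' (\<Phi>'' (R'' x)) = \<Phi>'' x"
  proof -
    have "T' (J (R'' m, 0), 0) = (J (m, 0), 0)" if m: "m \<in> Km" for m
    proof -
      have "U' 0 = 0" by (rule clinear_on_zero[OF unitary_opD(1)[OF U'] csubspace_UNIV])
      then have "?T (J (m, 0), 0) = (J (R'' m, 0), 0)"
        using T_D[OF D_mem[OF m zero_mem(2)]] V_J[OF m zero_mem(2)] by simp
      then show ?thesis
        using hadjoint_unitary_apply[OF T subK, of "(J (m, 0), 0)"] J_mem[OF m zero_mem(2)] z1
        by (simp add: T'_def)
    qed
    \<comment> \<open>A unitary and its adjoint have the same reducing subspaces.\<close>
    moreover have "star_cyclic R'' Km"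
      using cyclic(2) by (simp add: star_cyclic_def reducing_def unitary_adjoint(3)[OF U''] conj_ac)
    ultimately show ?thesis
      using star_cyclic_isometry_extension[OF R'' subKm _ _ K T', of "\<lambda>k. (J (k, 0), 0)"]
        that R''Km Jlin(2) nJ' z1 J_mem zero_mem by (auto simp: image_subset_iff)
  qed
  have T\<Phi>': "?T (\<Phi>' x) = \<Phi>' (R' x)" for x
    using \<Phi>'(5)[of "R' x"] by simp
  have T\<Phi>'': "?T (\<Phi>'' x) = \<Phi>'' (R'' x)" for x
  proof -
    have "?T (T' (\<Phi>'' (R'' x))) = \<Phi>'' (R'' x)"
      unfolding T'_def using \<Phi>''(2) by (intro unitary_apply_hadjoint[OF T subK]) auto
    then show ?thesis by (simp add: \<Phi>''(5))
  qed

  define Y where "Y x = hadjoint UNIV \<Phi>'' (\<Phi>' x)" for x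
  have UNIV: "closed_csubspace (UNIV :: 'b set)" by (simp add: closed_csubspace_iff)
  have Y: "cinner z (Y x) = cinner (\<Phi>'' z) (\<Phi>' x)" for z x
    unfolding Y_def by (rule cinner_hadjoint[OF UNIV \<Phi>''(1), of 1]) (simp_all add: \<Phi>''(3))
  have "clinear_on UNIV Y"
    unfolding clinear_on_def
    by (intro conjI ballI allI; rule cinner_eqI)
      (simp_all add: Y cinner_add_right cinner_scaleC_right clinear_onD[OF \<Phi>'(1)])
  moreover have "norm (Y x) \<le> norm x" for x
  proof -
    have "(norm (Y x))\<^sup>2 = cmod (cinner (Y x) (Y x))"
      by (rule cmod_cinner_self[symmetric])
    also have "\<dots> = cmod (cinner (\<Phi>'' (Y x)) (\<Phi>' x))"
      by (simp only: Y)
    also have "\<dots> \<le> norm (Y x) * norm x"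
      using norm_cinner_le[of "\<Phi>'' (Y x)" "\<Phi>' x"] by (simp add: \<Phi>'(3) \<Phi>''(3))
    finally show ?thesis
      by (cases "Y x = 0") (simp_all add: power2_eq_square)
  qed
  moreover have "Y (U' x) = U'' (Y x)" for x
  proof (rule cinner_eqI)
    fix z
    \<comment> \<open>Through the two embeddings the loop acts as \<open>R''\<close> and as
      \<open>R'\<close>, so its unitarity becomes the intertwining of \<open>Y\<close>.\<close>
    have "cinner z (U'' (Y x)) = cinner (R'' z) (Y x)"
      by (rule unitary_adjoint(2)[OF U''])
    also have "\<dots> = cinner (?T (\<Phi>'' z)) (?T (\<Phi>' (U' x)))"
      by (simp only: Y T\<Phi>'' \<Phi>'(5))
    also have "\<dots> = cinner (\<Phi>'' z) (\<Phi>' (U' x))"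
      using \<Phi>'(2) \<Phi>''(2) by (intro unitary_opD(4)[OF T]) auto
    finally show "cinner z (Y (U' x)) = cinner z (U'' (Y x))"
      by (simp only: Y)
  qed
  moreover have "proj Km (Y k) = X k" if k: "k \<in> Kp" for k
  proof (rule proj_eqI[OF subKm X_mem[OF k]])
    fix m assume m: "m \<in> Km"
    have "cinner m (Y k) = cinner m (X k)"
      using k m zero_mem X0 by (simp add: Y \<Phi>'(4) \<Phi>''(4) cinner_prod_def cinner_J)
    then show "cinner (Y k - X k) m = 0"
      using cinner_commute[of "Y k - X k" m] by (simp add: cinner_diff_right)
  qed
  ultimately have "contractive_intertwining_lift X U' U'' Kp Km Y"
    by (simp add: contractive_intertwining_lift_def contraction_op_def)
  moreover have "cinner (J (m, 0)) (fst ((?T ^^ n) (J (0, k), 0))) = cinner m (Y ((R' ^^ n) k))"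
    if m: "m \<in> Km" and k: "k \<in> Kp" for n m k
  proof -
    have "(?T ^^ n) (\<Phi>' k) = \<Phi>' ((R' ^^ n) k)"
      by (induction n) (simp_all add: T\<Phi>')
    then have "cinner m (Y ((R' ^^ n) k)) = cinner (J (m, 0), 0) ((?T ^^ n) (J (0, k), 0))"
      by (simp add: Y \<Phi>''(4)[OF m] \<Phi>'(4)[OF k, symmetric])
    then show ?thesis
      by (simp add: cinner_prod_def)
  qed
  ultimately show ?thesis by blast
qed

section \<open>Both implications at the level of symbols\<close>

lemma colligation_symbol_of_lift:
  assumes Y: "contractive_intertwining_lift X U' U'' Kp Km Y"
    and G: "G' \<subseteq> Kp" "G'' \<subseteq> Km" and w: "\<forall>n. \<forall>g\<in>G'. w n g = symbol U'' G'' Y n g"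
  shows "colligation_symbol TYPE('b \<times> 'a) G' G'' J H0 E F A0 j C0 w"
proof -
  obtain H1 :: "('b \<times> 'a) set" and A1 B1 C1 D1 where U1: "unitary_colligation H1 E F A1 B1 C1 D1"
    and traj: "\<forall>n. \<forall>m\<in>Km. \<forall>k\<in>Kp.
      cinner (J (m, 0)) (fst ((closed_loop A0 j C0 A1 B1 C1 D1 ^^ n) (J (0, k), 0)))
      = cinner m (Y ((R' ^^ n) k))"
    using colligation_of_lift[OF Y] by blast
  have "w n g = symbol_column G'' J H0 F A0 j C0 (io_map A1 B1 C1 D1) n g" if "g \<in> G'" for n g
    using symbol_eq_symbol_column[OF Y U1 _ G(2), of g n] traj w that G(1) by auto
  with U1 show ?thesis
    unfolding colligation_symbol_def by blast
qed

lemma lift_of_colligation_symbol: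
  assumes col: "colligation_symbol TYPE('g::chilbert_space) G' G'' J H0 E F A0 j C0 w"
    and G: "G' \<subseteq> Kp" "G'' \<subseteq> Km"
  shows "\<exists>Y. contractive_intertwining_lift X U' U'' Kp Km Y \<and>
    (\<forall>n. \<forall>g\<in>G'. w n g = symbol U'' G'' Y n g)"
proof -
  obtain H1 :: "'g set" and A1 B1 C1 D1 where U1: "unitary_colligation H1 E F A1 B1 C1 D1"
    and w: "\<And>n g. g \<in> G' \<Longrightarrow> w n g = symbol_column G'' J H0 F A0 j C0 (io_map A1 B1 C1 D1) n g"
    using col unfolding colligation_symbol_def by blast
  obtain Y where Y: "contractive_intertwining_lift X U' U'' Kp Km Y"
    and traj: "\<forall>n. \<forall>m\<in>Km. \<forall>k\<in>Kp.
      cinner (J (m, 0)) (fst ((closed_loop A0 j C0 A1 B1 C1 D1 ^^ n) (J (0, k), 0)))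
      = cinner m (Y ((R' ^^ n) k))"
    using lift_of_colligation[OF U1] by blast
  have "w n g = symbol U'' G'' Y n g" if "g \<in> G'" for n g
    using symbol_eq_symbol_column[OF Y U1 _ G(2), of g n] traj w[OF that] that G(1) by auto
  with Y show ?thesis by blast
qed

end

theorem theorem7p1:
  fixes U' :: "'a::chilbert_space \<Rightarrow> 'a" and U'' :: "'b::chilbert_space \<Rightarrow> 'b"
    and X :: "'a \<Rightarrow> 'b" and Kp G' :: "'a set" and Km G'' :: "'b set"
    and H0 \<D> \<D>s \<Delta> \<Delta>s :: "'h::chilbert_space set" and J :: "'b \<times> 'a \<Rightarrow> 'h"
    and \<Delta>t :: "'d::chilbert_space set" and i\<Delta> :: "'d \<Rightarrow> 'h"
    and \<Delta>st :: "'s::chilbert_space set" and i\<Delta>s :: "'s \<Rightarrow> 'h"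
    and A0 :: "'h \<Rightarrow> 'h" and B0 :: "'s \<Rightarrow> 'h" and C0 :: "'h \<Rightarrow> 'd"
    and w :: "int \<Rightarrow> 'a \<Rightarrow> 'b"
  assumes data: "lifting_data X U' U'' Kp Km"
    and H0: "gram_completion X Kp Km H0 J"
    and D: "\<D> = univ_dom U' Kp Km J" and Ds: "\<D>s = univ_ran U'' Kp Km J"
    and Delta: "\<Delta> = ominus H0 \<D>" and Deltas: "\<Delta>s = ominus H0 \<D>s"
    and copy: "closed_csubspace \<Delta>t" "unitary_op \<Delta>t \<Delta> i\<Delta>"
    and copys: "closed_csubspace \<Delta>st" "unitary_op \<Delta>st \<Delta>s i\<Delta>s"
    and A0: "A0 = univ_A U' U'' Kp Km J" and B0: "B0 = i\<Delta>s" and C0: "C0 = univ_C \<Delta> \<Delta>t i\<Delta>"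
    and G': "closed_csubspace G'" "G' \<subseteq> Kp" "star_cyclic U' G'"
    and G'': "closed_csubspace G''" "G'' \<subseteq> Km" "star_cyclic U'' G''"
    and w: "\<And>n. bounded_op G' G'' (w n)"
  shows "((\<exists>Y. contractive_intertwining_lift X U' U'' Kp Km Y \<and>
              (\<forall>n. \<forall>g\<in>G'. w n g = symbol U'' G'' Y n g))
          \<longleftrightarrow> colligation_symbol TYPE('b \<times> 'a) G' G'' J H0 \<Delta>t \<Delta>st A0 B0 C0 w) \<and>
         (colligation_symbol TYPE('h1::chilbert_space) G' G'' J H0 \<Delta>t \<Delta>st A0 B0 C0 w
          \<longrightarrow> (\<exists>Y. contractive_intertwining_lift X U' U'' Kp Km Y \<and>
                (\<forall>n. \<forall>g\<in>G'. w n g = symbol U'' G'' Y n g)))"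
proof -
  have setting: "lifting_setting U' U'' X Kp Km H0 J \<Delta>t i\<Delta> \<Delta>st i\<Delta>s"
    by unfold_locales (use data H0 copy copys D Ds Delta Deltas in auto)
  note A = lifting_setting.colligation_symbol_of_lift[OF setting _ G'(2) G''(2), of _ w]
    and B = lifting_setting.lift_of_colligation_symbol[OF setting _ G'(2) G''(2), of w]
  show ?thesis
    unfolding A0 B0 C0 Delta D
  proof (intro conjI iffI impI)
    assume "\<exists>Y. contractive_intertwining_lift X U' U'' Kp Km Y \<and>
      (\<forall>n. \<forall>g\<in>G'. w n g = symbol U'' G'' Y n g)"
    then obtain Y where "contractive_intertwining_lift X U' U'' Kp Km Y"
        "\<forall>n. \<forall>g\<in>G'. w n g = symbol U'' G'' Y n g"
      by blast
    then show "colligation_symbol TYPE('b \<times> 'a) G' G'' J H0 \<Delta>t \<Delta>st (univ_A U' U'' Kp Km J) i\<Delta>s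
        (univ_C (ominus H0 (univ_dom U' Kp Km J)) \<Delta>t i\<Delta>) w"
      by (rule A)
  \<comment> \<open>The two remaining goals are instances of one lemma, which is polymorphic in the
    type that carries \<open>H1\<close>.\<close>
  qed (erule B)+
qed

end
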